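(* Let $(M,g_{\mathrm{Page}})$ be the Page space with coordinates $(r,\theta,\phi,\psi)$, and consider the six families $S_1,\dots,S_6$ of coordinate surfaces (defined in the context) with the metrics induced from $g_{\mathrm{Page}}$. The constant Gaussian curvature surfaces in this list can be listed as follows: 1. The tori in the classes $S_1$ and $S_3$ are flat. 2. The spheres in the class $S_6$ are of constant positive curvature.
   Context: Definition of the Page space. Let $a\approx 0.28170$ be the unique positive root of $a^4+4a^3-6a^2+12a-3=0$. For $r\in[0,\pi]$ put $$V(r)=\frac{1-a^2\cos^2 r}{3-a^2-a^2(1+a^2)\cos^2 r},\qquad f(r)=4\,\frac{1-a^2\cos^2 r}{3+6a^2-a^4},\qquad C=\left(\frac{2}{3+a^2}\right)^2\approx 0.42183 .$$ On the unit sphere $S^3\subset\mathbb{R}^4$ use Euler angles $0\le\theta\le\pi$, $0\le\phi\le2\pi$, $0\le\psi\le4\pi$: $$x_1=\cos\tfrac{\theta}{2}\cos\tfrac{\psi+\phi}{2},\quad x_2=\cos\tfrac{\theta}{2}\sin\tfrac{\psi+\phi}{2},\quad x_3=\sin\tfrac{\theta}{2}\cos\tfrac{\psi-\phi}{2},\quad x_0=\sin\tfrac{\theta}{2}\sin\tfrac{\psi-\phi}{2},$$ in which the Hopf fibration $h:S^3\to S^2$ is the projection $h(\theta,\psi,\phi)=(-\phi,\theta)$ (so $\psi$ parametrizes the Hopf circles), and the invariant coframe $$\sigma_1=\tfrac12(\sin\psi\,d\theta-\sin\theta\cos\psi\,d\phi),\quad \sigma_2=\tfrac12(-\cos\psi\,d\theta-\sin\theta\sin\psi\,d\phi),\quad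 \sigma_3=\tfrac12(d\psi+\cos\theta\,d\phi).$$ On $S^3\times[0,\pi]$, with $r$ the coordinate on $[0,\pi]$, consider $$g=V(r)\,dr^2+f(r)(\sigma_1^2+\sigma_2^2)+\frac{C\sin^2 r}{V(r)}\,\sigma_3^2 .$$ The Page space is $M=(S^3\times[0,\pi])/\!\sim$, where $\sim$ collapses each fiber of the Hopf fibration $h$ to a point on each of the two ends $S^3\times\{0\}$ and $S^3\times\{\pi\}$, equipped with the metric $g_{\mathrm{Page}}$ to which $g$ descends. The manifold $M$ is the connected sum $\mathbb{CP}_2\sharp\overline{\mathbb{CP}}_2$. Families of surfaces (each family consists of the surfaces obtained for the various choices of the fixed values): - $S_1$: $r\in(0,\pi)$ and $\theta\in[0,\pi]$ fixed; $\psi,\phi$ vary (tori). - $S_2$: $\psi,\phi$ fixed; $r,\theta$ vary (cylinders, whose two ends lie on the two spheres $r=0$ and $r=\pi$). - $S_3$: $r,\phi$ fixed; $\psi,\theta$ vary (an embedded cylinder; passing beyond the chart and letting $\theta$ vary in $[0,2\pi]$ gives a torus, which degenerates to a circle parametrized by $\theta$ for $r=0,\pi$). - $S_4$: $\theta,\psi$ fixed; $r,\phi$ vary (cylinders, with boundary components on the spheres $r=0$ and $r=\pi$). - $S_5$: $\phi,\theta$ fixed; $r,\psi$ vary (spheres). - $S_6$: $r,\psi$ fixed; $\phi,\theta$ vary (spheres; $r=0$ and $r=\pi$ are allowed and give the two spheres at the ends). A surface is flat if its Gaussian curvature vanishes identically.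
   Formalization: Positive curvature in S6 is claimed only for members that are truly spheres (r=0,π); for 0<r<π they are discs, never of constant positive curvature. The list is complete except for flat S6 members with 0<r<π and f(r)=C sin²r/V(r), which the original list misses. *)

theory Defs
  imports "HOL-Analysis.Analysis"
begin

section \<open>Gaussian curvature of a Riemannian metric in coordinates\<close>

text \<open>A metric in coordinates \<open>u\<close> is a matrix-valued function \<open>g\<close> with entries \<open>g u $ i $ j\<close>.\<close>

definition partial_deriv :: "'n::finite \<Rightarrow> (real^'n \<Rightarrow> real) \<Rightarrow> real^'n \<Rightarrow> real" where
  "partial_deriv i F u = deriv (\<lambda>t. F (u + t *\<^sub>R axis i 1)) 0"

definition christoffel ::
  "(real^'n::finite \<Rightarrow> real^'n^'n) \<Rightarrow> 'n \<Rightarrow> 'n \<Rightarrow> 'n \<Rightarrow> real^'n \<Rightarrow> real" where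
  "christoffel g k i j u =
     (\<Sum>l\<in>UNIV. matrix_inv (g u) $ k $ l *
        (partial_deriv i (\<lambda>x. g x $ j $ l) u + partial_deriv j (\<lambda>x. g x $ i $ l) u
         - partial_deriv l (\<lambda>x. g x $ i $ j) u)) / 2"

text \<open>\<open>riemann g l i j k\<close> is the \<open>l\<close>-th component of
  \<open>R(\<partial>\<^sub>i,\<partial>\<^sub>j)\<partial>\<^sub>k = \<nabla>\<^sub>i\<nabla>\<^sub>j\<partial>\<^sub>k - \<nabla>\<^sub>j\<nabla>\<^sub>i\<partial>\<^sub>k\<close>.\<close>

definition riemann ::
  "(real^'n::finite \<Rightarrow> real^'n^'n) \<Rightarrow> 'n \<Rightarrow> 'n \<Rightarrow> 'n \<Rightarrow> 'n \<Rightarrow> real^'n \<Rightarrow> real" where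
  "riemann g l i j k u =
     partial_deriv i (christoffel g l j k) u - partial_deriv j (christoffel g l i k) u
     + (\<Sum>m\<in>UNIV. christoffel g m j k u * christoffel g l i m u
                   - christoffel g m i k u * christoffel g l j m u)"

definition gauss_curvature :: "(real^2 \<Rightarrow> real^2^2) \<Rightarrow> real^2 \<Rightarrow> real" where
  "gauss_curvature g u = (\<Sum>l\<in>UNIV. g u $ 1 $ l * riemann g l 1 2 2 u) / det (g u)"


section \<open>The Page metric\<close>

definition page_a :: real where
  "page_a = (THE a. a > 0 \<and> a^4 + 4 * a^3 - 6 * a^2 + 12 * a - 3 = 0)"

definition page_V :: "real \<Rightarrow> real" where
  "page_V r = (1 - page_a^2 * (cos r)^2)
     / (3 - page_a^2 - page_a^2 * (1 + page_a^2) * (cos r)^2)"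

definition page_f :: "real \<Rightarrow> real" where
  "page_f r = 4 * ((1 - page_a^2 * (cos r)^2) / (3 + 6 * page_a^2 - page_a^4))"

definition page_C :: real where
  "page_C = (2 / (3 + page_a^2))^2"

text \<open>Coordinates are \<open>(r, \<theta>, \<phi>, \<psi>)\<close>; a tangent vector is given by its components
  \<open>(dr, d\<theta>, d\<phi>, d\<psi>)\<close>. The formulas make sense for all real values of the angles, where they
  give the pullback under the Euler angle map below of the forms on the unit 3-sphere
  (possibly degenerate, since this map is singular where \<open>sin \<theta> = 0\<close>).\<close>

type_synonym coords = "real \<times> real \<times> real \<times> real"

fun sigma1 :: "coords \<Rightarrow> coords \<Rightarrow> real" where
  "sigma1 (r, \<theta>, \<phi>, \<psi>) (dr, d\<theta>, d\<phi>, d\<psi>) = (sin \<psi> * d\<theta> - sin \<theta> * cos \<psi> * d\<phi>) / 2"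

fun sigma2 :: "coords \<Rightarrow> coords \<Rightarrow> real" where
  "sigma2 (r, \<theta>, \<phi>, \<psi>) (dr, d\<theta>, d\<phi>, d\<psi>) = (- cos \<psi> * d\<theta> - sin \<theta> * sin \<psi> * d\<phi>) / 2"

fun sigma3 :: "coords \<Rightarrow> coords \<Rightarrow> real" where
  "sigma3 (r, \<theta>, \<phi>, \<psi>) (dr, d\<theta>, d\<phi>, d\<psi>) = (d\<psi> + cos \<theta> * d\<phi>) / 2"

definition page_metric :: "coords \<Rightarrow> coords \<Rightarrow> coords \<Rightarrow> real" where
  "page_metric p v w = (let r = fst p in
     page_V r * (fst v * fst w)
     + page_f r * (sigma1 p v * sigma1 p w + sigma2 p v * sigma2 p w)
     + page_C * (sin r)^2 / page_V r * (sigma3 p v * sigma3 p w))"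


section \<open>The Page space\<close>

text \<open>Points of \<open>\<real>\<^sup>4\<close> are written \<open>(x\<^sub>0, x\<^sub>1, x\<^sub>2, x\<^sub>3)\<close>.\<close>

type_synonym R4 = "real \<times> real \<times> real \<times> real"

definition euler :: "real \<Rightarrow> real \<Rightarrow> real \<Rightarrow> R4" where
  "euler \<theta> \<phi> \<psi> =
     (sin (\<theta>/2) * sin ((\<psi> - \<phi>)/2), cos (\<theta>/2) * cos ((\<psi> + \<phi>)/2),
      cos (\<theta>/2) * sin ((\<psi> + \<phi>)/2), sin (\<theta>/2) * cos ((\<psi> - \<phi>)/2))"

fun hopf :: "R4 \<Rightarrow> real \<times> real \<times> real" where
  "hopf (x0, x1, x2, x3) =
     (2 * (x1 * x3 + x2 * x0), 2 * (x1 * x0 - x2 * x3), x1^2 + x2^2 - x3^2 - x0^2)"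

text \<open>The Hopf map sends the point with Euler angles \<open>(\<theta>, \<psi>, \<phi>)\<close> to the point of the 2-sphere
  with longitude \<open>- \<phi>\<close> and colatitude \<open>\<theta>\<close>.\<close>

lemma hopf_euler:
  "hopf (euler \<theta> \<phi> \<psi>) = (sin \<theta> * cos (- \<phi>), sin \<theta> * sin (- \<phi>), cos \<theta>)"
proof -
  define A B t where "A = (\<psi> + \<phi>)/2" and "B = (\<psi> - \<phi>)/2" and "t = \<theta>/2"
  have \<phi>: "- \<phi> = B - A" and \<theta>: "\<theta> = 2 * t"
    by (simp_all add: A_def B_def t_def field_simps)
  have "(cos t * cos A)^2 + (cos t * sin A)^2 - (sin t * cos B)^2 - (sin t * sin B)^2
      = (cos t)^2 * ((sin A)^2 + (cos A)^2) - (sin t)^2 * ((sin B)^2 + (cos B)^2)"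
    unfolding power_mult_distrib by algebra
  also have "\<dots> = cos (2 * t)"
    by (simp add: cos_double)
  finally have 1: "(cos t * cos A)^2 + (cos t * sin A)^2 - (sin t * cos B)^2 - (sin t * sin B)^2
      = cos (2 * t)" .
  show ?thesis
    unfolding \<phi> unfolding euler_def A_def[symmetric] B_def[symmetric] t_def[symmetric]
    unfolding \<theta> sin_double using 1 by (simp add: cos_diff sin_diff) (simp add: algebra_simps)
qed

definition page_dom :: "(R4 \<times> real) set" where
  "page_dom = sphere 0 1 \<times> {0..pi}"

definition page_rel :: "((R4 \<times> real) \<times> (R4 \<times> real)) set" where
  "page_rel = {((x, r), (y, s)). (x, r) \<in> page_dom \<and> (y, s) \<in> page_dom \<and> r = s \<and>
      (x = y \<or> (r \<in> {0, pi} \<and> hopf x = hopf y))}"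

definition page_proj :: "R4 \<times> real \<Rightarrow> (R4 \<times> real) set" where
  "page_proj p = page_rel `` {p}"

definition page_space :: "(R4 \<times> real) set topology" where
  "page_space = topology (\<lambda>U. U \<subseteq> page_dom // page_rel \<and>
      openin (top_of_set page_dom) {p \<in> page_dom. page_proj p \<in> U})"

lemma page_proj_in: "p \<in> page_dom \<Longrightarrow> page_proj p \<in> page_dom // page_rel"
  by (auto simp: page_proj_def quotient_def)

lemma openin_page_space:
  "openin page_space U \<longleftrightarrow> U \<subseteq> page_dom // page_rel \<and>
     openin (top_of_set page_dom) {p \<in> page_dom. page_proj p \<in> U}"
proof -
  let ?P = "\<lambda>U. U \<subseteq> page_dom // page_rel \<and>
      openin (top_of_set page_dom) {p \<in> page_dom. page_proj p \<in> U}"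
  have "istopology ?P"
    unfolding istopology_def
  proof (intro conjI allI impI)
    fix S T assume S: "?P S" and T: "?P T"
    then show "S \<inter> T \<subseteq> page_dom // page_rel" by blast
    have "{p \<in> page_dom. page_proj p \<in> S \<inter> T}
        = {p \<in> page_dom. page_proj p \<in> S} \<inter> {p \<in> page_dom. page_proj p \<in> T}" by blast
    then show "openin (top_of_set page_dom) {p \<in> page_dom. page_proj p \<in> S \<inter> T}"
      using S T by (simp only: openin_Int)
  next
    fix K assume K: "\<forall>S\<in>K. ?P S"
    then show "\<Union>K \<subseteq> page_dom // page_rel" by blast
    have "{p \<in> page_dom. page_proj p \<in> \<Union>K}
        = (\<Union>S\<in>K. {p \<in> page_dom. page_proj p \<in> S})" by blast
    then show "openin (top_of_set page_dom) {p \<in> page_dom. page_proj p \<in> \<Union>K}"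
      using K by (simp only: openin_Union) blast
  qed
  then show ?thesis
    by (simp add: page_space_def)
qed

lemma topspace_page_space: "topspace page_space = page_dom // page_rel"
proof -
  have "{p \<in> page_dom. page_proj p \<in> page_dom // page_rel} = page_dom"
    using page_proj_in by blast
  then have "openin page_space (page_dom // page_rel)"
    by (simp add: openin_page_space)
  then show ?thesis
    by (auto simp: topspace_def openin_page_space)
qed

lemma quotient_map_page_proj: "quotient_map (top_of_set page_dom) page_space page_proj"
  unfolding quotient_map_def topspace_page_space
  by (auto simp: openin_page_space page_proj_in page_proj_def quotient_def)


section \<open>Coordinate surfaces\<close>

record surface =
  pdom :: "(real^2) set"
  pmap :: "real^2 \<Rightarrow> coords"

definition rect :: "real \<Rightarrow> real \<Rightarrow> real \<Rightarrow> real \<Rightarrow> (real^2) set" where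
  "rect a b c d = cbox (vector [a, c]) (vector [b, d])"

text \<open>The set of points of a surface, in the quotient.\<close>

definition carrier_space :: "surface \<Rightarrow> (R4 \<times> real) set topology" where
  "carrier_space S = subtopology page_space
     ((\<lambda>u. case pmap S u of (r, \<theta>, \<phi>, \<psi>) \<Rightarrow> page_proj (euler \<theta> \<phi> \<psi>, r)) ` pdom S)"

definition is_sphere :: "surface \<Rightarrow> bool" where
  "is_sphere S \<longleftrightarrow> carrier_space S homeomorphic_space top_of_set (sphere (0::real^3) 1)"

definition is_torus :: "surface \<Rightarrow> bool" where
  "is_torus S \<longleftrightarrow>
     carrier_space S homeomorphic_space top_of_set (sphere (0::complex) 1 \<times> sphere (0::complex) 1)"

definition induced_metric :: "surface \<Rightarrow> real^2 \<Rightarrow> real^2^2" where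
  "induced_metric S u = (\<chi> i j. page_metric (pmap S u)
      (vector_derivative (\<lambda>t. pmap S (u + t *\<^sub>R axis i 1)) (at 0))
      (vector_derivative (\<lambda>t. pmap S (u + t *\<^sub>R axis j 1)) (at 0)))"

text \<open>The curvature is computed on the interior of the parameter domain, where the induced form has
  to be a Riemannian metric. Hence a coordinate surface that degenerates to a circle does not have
  constant curvature in this sense. By continuity, the points parametrized by the boundary impose
  no further condition.\<close>

definition const_curvature :: "surface \<Rightarrow> real \<Rightarrow> bool" where
  "const_curvature S k \<longleftrightarrow> (\<forall>u \<in> interior (pdom S).
     (\<forall>v. v \<noteq> 0 \<longrightarrow> v \<bullet> (induced_metric S u *v v) > 0) \<and>
     gauss_curvature (induced_metric S) u = k)"

definition flat :: "surface \<Rightarrow> bool" where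
  "flat S \<longleftrightarrow> const_curvature S 0"

definition S1 :: "surface set" where
  "S1 = {\<lparr>pdom = rect 0 (4 * pi) 0 (2 * pi), pmap = (\<lambda>u. (r, \<theta>, u$2, u$1))\<rparr> | r \<theta>.
     r \<in> {0<..<pi} \<and> \<theta> \<in> {0..pi}}"

definition S2 :: "surface set" where
  "S2 = {\<lparr>pdom = rect 0 pi 0 pi, pmap = (\<lambda>u. (u$1, u$2, \<phi>, \<psi>))\<rparr> | \<phi> \<psi>.
     \<phi> \<in> {0..2 * pi} \<and> \<psi> \<in> {0..4 * pi}}"

text \<open>In \<open>S3\<close> the angle \<open>\<theta>\<close> runs over \<open>[0,2\<pi>]\<close>, beyond the chart, so that the surface closes
  up.\<close>

definition S3 :: "surface set" where
  "S3 = {\<lparr>pdom = rect 0 (4 * pi) 0 (2 * pi), pmap = (\<lambda>u. (r, u$2, \<phi>, u$1))\<rparr> | r \<phi>.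
     r \<in> {0..pi} \<and> \<phi> \<in> {0..2 * pi}}"

definition S4 :: "surface set" where
  "S4 = {\<lparr>pdom = rect 0 pi 0 (2 * pi), pmap = (\<lambda>u. (u$1, \<theta>, u$2, \<psi>))\<rparr> | \<theta> \<psi>.
     \<theta> \<in> {0..pi} \<and> \<psi> \<in> {0..4 * pi}}"

definition S5 :: "surface set" where
  "S5 = {\<lparr>pdom = rect 0 pi 0 (4 * pi), pmap = (\<lambda>u. (u$1, \<theta>, \<phi>, u$2))\<rparr> | \<theta> \<phi>.
     \<theta> \<in> {0..pi} \<and> \<phi> \<in> {0..2 * pi}}"

text \<open>A member of \<open>S6\<close> with \<open>0 < r < \<pi>\<close> is not closed: over the poles of the base \<open>\<phi>\<close> runs through
  half a Hopf circle, and \<open>\<phi> = 0\<close> and \<open>\<phi> = 2\<pi>\<close> give antipodal points of the 3-sphere.\<close>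

definition S6_surface :: "real \<Rightarrow> real \<Rightarrow> surface" where
  "S6_surface r \<psi> = \<lparr>pdom = rect 0 (2 * pi) 0 pi, pmap = (\<lambda>u. (r, u$2, u$1, \<psi>))\<rparr>"

definition S6 :: "surface set" where
  "S6 = {S6_surface r \<psi> | r \<psi>. r \<in> {0..pi} \<and> \<psi> \<in> {0..4 * pi}}"

end

theory Submission
  imports Defs
begin

text \<open>On each coordinate surface the induced metric has coefficients that depend on at most one of the
  two parameters, so the whole question is about elementary metrics on rectangles. Write \<open>f\<close> for the
  coefficient of \<open>\<sigma>\<^sub>1\<^sup>2 + \<sigma>\<^sub>2\<^sup>2\<close> and \<open>h\<close> (here \<open>page_h\<close>) for that of \<open>\<sigma>\<^sub>3\<^sup>2\<close>; \<open>f\<close> is positive everywhere, \<open>h\<close>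
  vanishes exactly at the two ends \<open>r = 0\<close> and \<open>r = \<pi>\<close>.

  On \<open>S1\<close> and \<open>S3\<close> the coefficients are constants. Such a metric is flat as soon as it is
  nondegenerate, which fails exactly when the surface collapses to a circle (\<open>sin \<theta> = 0\<close> for \<open>S1\<close>, an
  end of the \<open>r\<close>-interval for \<open>S3\<close>). So flatness and being a torus go together, provided that the
  nondegenerate surfaces really are tori and a circle is not a torus.

  On \<open>S2\<close>, \<open>S4\<close> and \<open>S5\<close> the metric is \<open>V dr\<^sup>2 + (\<alpha> f + \<beta> h) dt\<^sup>2\<close> with constants \<open>\<alpha>, \<beta> \<ge> 0\<close>. In the
  variable \<open>c = cos r\<close> everything is rational: \<open>V = P/Q\<close>, \<open>f\<close> is a multiple of \<open>P\<close> and
  \<open>h = C (1 - c\<^sup>2) Q/P\<close>, where \<open>P = 1 - a\<^sup>2 c\<^sup>2\<close>. Constant curvature is then an identity of polynomials on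
  \<open>-1 < c < 1\<close>, hence everywhere, and it can be tested at the zero \<open>c = 1/a\<close> of \<open>P\<close>, far outside the
  geometric range. Comparing the orders of the poles there gives a contradiction for every \<open>\<alpha>, \<beta>\<close>
  that are not both zero (\<open>radial_metric_not_constant_curvature\<close>). The argument needs \<open>0 < a < 1\<close>,
  which makes all coefficients regular and \<open>1/a\<close> neither a zero of \<open>Q\<close> nor equal to \<open>\<plusminus>1\<close>.

  On \<open>S6\<close> the metric is \<open>(A sin\<^sup>2 \<theta> + B cos\<^sup>2 \<theta>) d\<phi>\<^sup>2 + A d\<theta>\<^sup>2\<close> with \<open>A = f/4\<close>, \<open>B = h/4\<close>. At the ends
  \<open>B = 0\<close>, and this is a round sphere of curvature \<open>1/A\<close>. For \<open>0 < r < \<pi>\<close> the explicit curvature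
  (\<open>S6_gauss_curvature\<close>) is constant only if \<open>A = B\<close>, and then it is zero.

  The topological side rests on one principle: the quotient map is well behaved on compact saturated
  sets, so a surface in a slice \<open>0 < r < \<pi>\<close> is homeomorphic to its image in the 3-sphere, and a surface
  in an end to the image of that under the Hopf map. Thus \<open>S1\<close> and \<open>S3\<close> give tori in the 3-sphere, the
  end members of \<open>S6\<close> give the full 2-sphere, and the other members of \<open>S6\<close> are embedded closed discs,
  which are contractible and therefore no spheres.\<close>

section \<open>Curvature of orthogonal metrics on the plane\<close>

text \<open>Partial derivatives are handled as a relation, so that existence and value come together.\<close>

abbreviation has_partial :: "(real^'n::finite \<Rightarrow> real) \<Rightarrow> 'n \<Rightarrow> real \<Rightarrow> real^'n \<Rightarrow> bool" where
  "has_partial F i D u \<equiv> ((\<lambda>t. F (u + t *\<^sub>R axis i 1)) has_real_derivative D) (at 0)"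

lemma eventually_on_line:
  fixes u w :: "'a::real_normed_vector"
  assumes "open U" "u \<in> U"
  shows "\<forall>\<^sub>F t in nhds (0::real). u + t *\<^sub>R w \<in> U"
proof -
  have "((\<lambda>t::real. u + t *\<^sub>R w) \<longlongrightarrow> u + 0 *\<^sub>R w) (nhds 0)"
    by (intro tendsto_intros filterlim_ident)
  then show ?thesis
    using assms topological_tendstoD by fastforce
qed

text \<open>Partial derivatives are local; this allows replacing the metric coefficients by formulas that hold
  only on an open set, such as the set where the metric is nondegenerate.\<close>

lemma partial_deriv_eqI:
  assumes U: "open U" "u \<in> U" and eq: "\<And>x. x \<in> U \<Longrightarrow> F x = G x" and G: "has_partial G i D u"
  shows "partial_deriv i F u = D"
proof -
  have "deriv (\<lambda>t. F (u + t *\<^sub>R axis i 1)) 0 = deriv (\<lambda>t. G (u + t *\<^sub>R axis i 1)) 0"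
    using eventually_on_line[OF U, of "axis i 1"]
    by (intro deriv_cong_ev) (auto elim!: eventually_mono simp: eq)
  then show ?thesis
    using G by (simp add: partial_deriv_def DERIV_imp_deriv)
qed

lemma has_partial_coordinate:
  fixes p :: "real \<Rightarrow> real"
  assumes "(p has_real_derivative D) (at (u $ i))"
  shows "has_partial (\<lambda>x. p (x $ i)) i D u"
proof -
  have "((\<lambda>t. p (u $ i + t)) has_real_derivative D * (0 + 1)) (at 0)"
    by (rule DERIV_chain2[where f = p]) (use assms in \<open>auto intro!: derivative_eq_intros\<close>)
  then show ?thesis by (simp add: axis_def)
qed

lemma has_partial_other_coordinate:
  "i \<noteq> j \<Longrightarrow> has_partial (\<lambda>x. p (x $ i)) j 0 u"
  by (simp add: axis_def)

lemma has_partial_const: "has_partial (\<lambda>x. c) j 0 u"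
  by simp

lemma matrix_inv_diagonal_2:
  fixes A :: "real^2^2"
  assumes A: "A $ 1 $ 1 = e" "A $ 1 $ 2 = 0" "A $ 2 $ 1 = 0" "A $ 2 $ 2 = h" and "e \<noteq> 0" "h \<noteq> 0"
  shows "matrix_inv A $ 1 $ 1 = 1 / e" "matrix_inv A $ 1 $ 2 = 0"
    "matrix_inv A $ 2 $ 1 = 0" "matrix_inv A $ 2 $ 2 = 1 / h"
proof -
  define B :: "real^2^2" where "B = (\<chi> i j. if i = j then 1 / A $ i $ i else 0)"
  have AB: "A ** B = mat 1" "B ** A = mat 1"
    using assms by (auto simp: B_def vec_eq_iff matrix_matrix_mult_def sum_2 forall_2 mat_def)
  have "A ** matrix_inv A = mat 1 \<and> matrix_inv A ** A = mat 1"
    unfolding matrix_inv_def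
    by (rule someI[where P = "\<lambda>A'. A ** A' = mat 1 \<and> A' ** A = mat 1" and x = B]) (simp add: AB)
  then have "B = (matrix_inv A ** A) ** B" by simp
  also have "\<dots> = matrix_inv A"
    by (simp only: matrix_mul_assoc[symmetric] AB matrix_mul_rid)
  finally have "matrix_inv A = B" by simp
  then show "matrix_inv A $ 1 $ 1 = 1 / e" "matrix_inv A $ 1 $ 2 = 0"
    "matrix_inv A $ 2 $ 1 = 0" "matrix_inv A $ 2 $ 2 = 1 / h"
    using A by (auto simp: B_def)
qed

text \<open>All Christoffel symbols are zero, whatever the matrix is, so nondegeneracy has to be asked
  separately in the definition of constant curvature.\<close>

lemma gauss_curvature_constant_metric: "gauss_curvature (\<lambda>_. A) u = 0"
proof -
  have "christoffel (\<lambda>_. A) k i j x = 0" for k i j x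
    by (simp add: christoffel_def partial_deriv_def)
  then show ?thesis
    by (simp add: gauss_curvature_def riemann_def partial_deriv_def)
qed

text \<open>The classical formula for \<open>e du\<^sup>2 + h dv\<^sup>2\<close> (indices are partial derivatives). Since the metric is
  diagonal, its inverse is explicit, each Christoffel symbol is a single quotient, and only
  \<open>R(\<partial>\<^sub>1,\<partial>\<^sub>2)\<partial>\<^sub>2\<close> in direction \<open>\<partial>\<^sub>1\<close> contributes.\<close>

lemma gauss_curvature_orthogonal:
  fixes g :: "real^2 \<Rightarrow> real^2^2"
  assumes U: "open U" "u \<in> U"
    and g: "\<And>x. x \<in> U \<Longrightarrow> g x $ 1 $ 1 = e x" "\<And>x. x \<in> U \<Longrightarrow> g x $ 1 $ 2 = 0"
      "\<And>x. x \<in> U \<Longrightarrow> g x $ 2 $ 1 = 0" "\<And>x. x \<in> U \<Longrightarrow> g x $ 2 $ 2 = h x"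
    and nz: "\<And>x. x \<in> U \<Longrightarrow> e x \<noteq> 0" "\<And>x. x \<in> U \<Longrightarrow> h x \<noteq> 0"
    and e1: "\<And>x. x \<in> U \<Longrightarrow> has_partial e 1 (e1 x) x"
    and e2: "\<And>x. x \<in> U \<Longrightarrow> has_partial e 2 (e2 x) x"
    and h1: "\<And>x. x \<in> U \<Longrightarrow> has_partial h 1 (h1 x) x"
    and h2: "\<And>x. x \<in> U \<Longrightarrow> has_partial h 2 (h2 x) x"
    and e22: "has_partial e2 2 e22 u" and h11: "has_partial h1 1 h11 u"
  shows "gauss_curvature g u =
    (- e22 / (2 * e u) - h11 / (2 * e u) + h1 u * e1 u / (4 * (e u)^2) + (e2 u)^2 / (4 * (e u)^2)
     + h2 u * e2 u / (4 * e u * h u) + (h1 u)^2 / (4 * e u * h u)) / h u"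
proof -
  have p: "partial_deriv i (\<lambda>x. g x $ 1 $ 2) x = 0" "partial_deriv i (\<lambda>x. g x $ 2 $ 1) x = 0"
      "partial_deriv 1 (\<lambda>x. g x $ 1 $ 1) x = e1 x" "partial_deriv 2 (\<lambda>x. g x $ 1 $ 1) x = e2 x"
      "partial_deriv 1 (\<lambda>x. g x $ 2 $ 2) x = h1 x" "partial_deriv 2 (\<lambda>x. g x $ 2 $ 2) x = h2 x"
    if "x \<in> U" for x i
    using partial_deriv_eqI[OF U(1) that g(1) e1[OF that]] partial_deriv_eqI[OF U(1) that g(1) e2[OF that]]
      partial_deriv_eqI[OF U(1) that g(4) h1[OF that]] partial_deriv_eqI[OF U(1) that g(4) h2[OF that]]
      partial_deriv_eqI[OF U(1) that g(2) has_partial_const] partial_deriv_eqI[OF U(1) that g(3) has_partial_const]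
    by auto
  have christoffel:
    "christoffel g 1 1 1 x = e1 x / (2 * e x)" "christoffel g 1 1 2 x = e2 x / (2 * e x)"
    "christoffel g 1 2 2 x = - h1 x / (2 * e x)" "christoffel g 2 2 2 x = h2 x / (2 * h x)"
    "christoffel g 2 1 2 x = h1 x / (2 * h x)" "christoffel g 1 2 1 x = e2 x / (2 * e x)"
    if "x \<in> U" for x
    using matrix_inv_diagonal_2[OF g[OF that] nz[OF that]]
    by (simp_all add: christoffel_def sum_2 p[OF that])
  have d1: "partial_deriv 1 (christoffel g 1 2 2) u
      = - (h11 / (2 * e u)) + h1 u * e1 u / (2 * (e u)^2)"
  proof (rule partial_deriv_eqI[OF U christoffel(3)])
    show "has_partial (\<lambda>x. - h1 x / (2 * e x)) 1 (- (h11 / (2 * e u)) + h1 u * e1 u / (2 * (e u)^2)) u"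
      using nz(1)[OF U(2)]
      by (intro DERIV_cong[OF DERIV_divide[OF DERIV_minus[OF h11] DERIV_cmult[OF e1[OF U(2)]]]])
        (simp_all add: field_simps power2_eq_square)
  qed
  have d2: "partial_deriv 2 (christoffel g 1 1 2) u
      = e22 / (2 * e u) - (e2 u)^2 / (2 * (e u)^2)"
  proof (rule partial_deriv_eqI[OF U christoffel(2)])
    show "has_partial (\<lambda>x. e2 x / (2 * e x)) 2 (e22 / (2 * e u) - (e2 u)^2 / (2 * (e u)^2)) u"
      using nz(1)[OF U(2)]
      by (intro DERIV_cong[OF DERIV_divide[OF e22 DERIV_cmult[OF e2[OF U(2)]]]])
        (simp_all add: field_simps power2_eq_square)
  qed
  have R: "riemann g 1 1 2 2 u =
     - e22 / (2 * e u) - h11 / (2 * e u) + h1 u * e1 u / (4 * (e u)^2) + (e2 u)^2 / (4 * (e u)^2)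
     + h2 u * e2 u / (4 * e u * h u) + (h1 u)^2 / (4 * e u * h u)"
  proof -
    have combine: "(- (h11 / (2*E)) + H1*E1 / (2*E^2)) - (e22 / (2*E) - E2^2 / (2*E^2))
        + ((- H1 / (2*E)) * (E1 / (2*E)) - (E2 / (2*E)) * (E2 / (2*E))
         + ((H2 / (2*H)) * (E2 / (2*E)) - (H1 / (2*H)) * (- H1 / (2*E))))
      = - e22 / (2*E) - h11 / (2*E) + H1*E1 / (4*E^2) + E2^2 / (4*E^2)
        + H2*E2 / (4*E*H) + H1^2 / (4*E*H)" if "E \<noteq> 0" "H \<noteq> 0" for E H E1 E2 H1 H2 :: real
      using that by (simp add: field_simps power2_eq_square)
    show ?thesis
      unfolding riemann_def sum_2 d1 d2 christoffel[OF U(2)] by (rule combine[OF nz[OF U(2)]])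
  qed
  have "gauss_curvature g u = e u * riemann g 1 1 2 2 u / (e u * h u)"
    by (simp add: gauss_curvature_def sum_2 g[OF U(2)] det_2)
  then show ?thesis
    using nz[OF U(2)] by (simp add: R)
qed

section \<open>The coefficients of the Page metric\<close>

text \<open>The quartic increases on the positive axis, because its derivative is
  \<open>4 a\<^sup>3 + 12 ((a - 1/2)\<^sup>2 + 3/4)\<close>, and it changes sign between \<open>0\<close> and \<open>1\<close>. So the definite description
  denotes a root, and the root lies in this interval.\<close>

lemma page_a_bounds: "0 < page_a" "page_a < 1"
proof -
  define p :: "real \<Rightarrow> real" where "p a = a^4 + 4 * a^3 - 6 * a^2 + 12 * a - 3" for a
  have mono: "p x < p y" if "0 \<le> x" "x < y" for x y
  proof (rule DERIV_pos_imp_increasing[OF \<open>x < y\<close>])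
    fix a :: real
    assume "x \<le> a" "a \<le> y"
    have "(p has_real_derivative 4*a^3 + 12*((a - 1/2)^2 + 3/4)) (at a)"
      unfolding p_def by (auto intro!: derivative_eq_intros simp: power2_eq_square algebra_simps)
    moreover have "4*a^3 + 12*((a - 1/2)^2 + 3/4) > 0"
      using \<open>0 \<le> x\<close> \<open>x \<le> a\<close> by (intro add_nonneg_pos) (auto intro: add_nonneg_pos)
    ultimately show "\<exists>y. DERIV p a :> y \<and> y > 0" by blast
  qed
  have "\<exists>a. 0 \<le> a \<and> a \<le> 1 \<and> p a = 0"
    by (rule IVT') (auto simp: p_def intro!: continuous_intros)
  then obtain a where a: "0 \<le> a" "a \<le> 1" "p a = 0" by blast
  then have "a \<noteq> 0" "a \<noteq> 1" by (auto simp: p_def)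
  with a have a01: "0 < a" "a < 1" by auto
  have "page_a = a"
    unfolding page_a_def p_def[symmetric]
  proof (rule the_equality)
    show "b = a" if "0 < b \<and> p b = 0" for b
      using mono[of a b] mono[of b a] a that by (cases a b rule: linorder_cases) auto
  qed (use a a01 in auto)
  with a01 show "0 < page_a" "page_a < 1" by auto
qed

text \<open>Numerator and denominator of \<open>V\<close> as polynomials in \<open>cos r\<close>; \<open>page_N\<close> is the constant
  denominator of \<open>f\<close>.\<close>

definition page_P :: "real poly" where
  "page_P = [:1, 0, - (page_a^2):]"

definition page_Q :: "real poly" where
  "page_Q = [:3 - page_a^2, 0, - (page_a^2 * (1 + page_a^2)):]"

definition page_N :: real where
  "page_N = 3 + 6 * page_a^2 - page_a^4"

text \<open>The coefficient of \<open>\<sigma>\<^sub>3\<^sup>2\<close>: the squared length of the Hopf circles, up to a constant.\<close>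

definition page_h :: "real \<Rightarrow> real" where
  "page_h r = page_C * (sin r)^2 / page_V r"

lemma page_a_square: "0 < page_a^2" "page_a^2 < 1"
  using page_a_bounds by (auto simp: power_less_one_iff)

lemma page_poly_pos:
  assumes "c^2 \<le> 1"
  shows "poly page_P c > 0" "poly page_Q c > 0"
proof -
  let ?a = "page_a^2"
  have "?a * c^2 \<le> ?a * 1" "?a * (1 + ?a) * c^2 \<le> ?a * (1 + ?a) * 1"
    using assms by (intro mult_left_mono; simp)+
  moreover have "?a * ?a < 1 * 1"
    using page_a_square by (intro mult_strict_mono) auto
  ultimately show "poly page_P c > 0" "poly page_Q c > 0"
    using page_a_square by (auto simp: page_P_def page_Q_def power2_eq_square algebra_simps)
qed

lemma page_N_pos: "page_N > 0"
proof -
  have "page_a^4 = page_a^2 * page_a^2" by (simp flip: power_add)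
  moreover have "page_a^2 * page_a^2 < 1 * 1"
    using page_a_square by (intro mult_strict_mono) auto
  ultimately show ?thesis
    using page_a_square unfolding page_N_def by linarith
qed

lemma page_C_pos: "page_C > 0"
proof -
  have "3 + page_a^2 > 0" using page_a_square by linarith
  then show ?thesis by (simp add: page_C_def)
qed

lemma page_V_eq: "page_V r = poly page_P (cos r) / poly page_Q (cos r)"
  by (simp add: page_V_def page_P_def page_Q_def power2_eq_square algebra_simps)

lemma page_f_eq: "page_f r = 4 * poly page_P (cos r) / page_N"
  by (simp add: page_f_def page_P_def page_N_def power2_eq_square algebra_simps)

lemma page_V_pos: "page_V r > 0"
  by (simp add: page_V_eq page_poly_pos abs_square_le_1)

lemma page_f_pos: "page_f r > 0"
  by (simp add: page_f_eq page_poly_pos page_N_pos abs_square_le_1)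

lemma page_h_eq:
  "page_h r = page_C * (1 - (cos r)^2) * poly page_Q (cos r) / poly page_P (cos r)"
  by (simp add: page_h_def page_V_eq sin_squared_eq)

lemma page_h_nonneg: "page_h r \<ge> 0"
  using page_C_pos page_V_pos[of r] by (simp add: page_h_def)

lemma page_h_pos: "0 < r \<Longrightarrow> r < pi \<Longrightarrow> page_h r > 0"
  using page_C_pos page_V_pos[of r] sin_gt_zero[of r] by (simp add: page_h_def)

lemma page_h_ends: "r \<in> {0, pi} \<Longrightarrow> page_h r = 0"
  by (auto simp: page_h_def)

text \<open>The form \<open>\<sigma>\<^sub>1\<^sup>2 + \<sigma>\<^sub>2\<^sup>2\<close> is a quarter of the round metric on the base of the Hopf fibration, since the
  rotation by \<open>\<psi>\<close> that relates \<open>\<sigma>\<^sub>1, \<sigma>\<^sub>2\<close> to \<open>d\<theta>, sin \<theta> d\<phi>\<close> is an isometry.\<close>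

lemma page_metric_coordinates:
  "page_metric (r, \<theta>, \<phi>, \<psi>) (a, b, c, d) (a', b', c', d') =
     page_V r * (a * a') + page_f r / 4 * (b * b' + (sin \<theta>)^2 * (c * c'))
     + page_h r / 4 * ((d + cos \<theta> * c) * (d' + cos \<theta> * c'))"
proof -
  have "sigma1 (r, \<theta>, \<phi>, \<psi>) (a, b, c, d) * sigma1 (r, \<theta>, \<phi>, \<psi>) (a', b', c', d')
      + sigma2 (r, \<theta>, \<phi>, \<psi>) (a, b, c, d) * sigma2 (r, \<theta>, \<phi>, \<psi>) (a', b', c', d')
      = ((sin \<psi>)^2 + (cos \<psi>)^2) * (b * b' + (sin \<theta>)^2 * (c * c')) / 4"
    by (simp add: power2_eq_square field_simps del: sin_cos_squared_add sin_cos_squared_add2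
        sin_cos_squared_add3)
  then show ?thesis
    by (simp add: page_metric_def page_h_def Let_def sigma3.simps del: sigma1.simps sigma2.simps)
qed

section \<open>Induced metrics on affine coordinate surfaces\<close>

text \<open>Every coordinate surface is parametrized by an affine map, whose tangent vectors are constant.\<close>

lemma induced_metric_affine:
  assumes S: "\<And>u. pmap S u = p + (u $ 1) *\<^sub>R v + (u $ 2) *\<^sub>R w"
  shows "induced_metric S u $ 1 $ 1 = page_metric (pmap S u) v v"
    "induced_metric S u $ 1 $ 2 = page_metric (pmap S u) v w"
    "induced_metric S u $ 2 $ 1 = page_metric (pmap S u) w v"
    "induced_metric S u $ 2 $ 2 = page_metric (pmap S u) w w"
proof -
  have line: "vector_derivative (\<lambda>t. q + t *\<^sub>R x) (at 0) = x" for q x :: coords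
    by (rule vector_derivative_at) (auto intro!: derivative_eq_intros)
  have "(\<lambda>t. pmap S (u + t *\<^sub>R axis 1 1)) = (\<lambda>t. pmap S u + t *\<^sub>R v)"
       "(\<lambda>t. pmap S (u + t *\<^sub>R axis 2 1)) = (\<lambda>t. pmap S u + t *\<^sub>R w)"
    by (auto simp: S axis_def scaleR_add_left algebra_simps)
  then show "induced_metric S u $ 1 $ 1 = page_metric (pmap S u) v v"
    "induced_metric S u $ 1 $ 2 = page_metric (pmap S u) v w"
    "induced_metric S u $ 2 $ 1 = page_metric (pmap S u) w v"
    "induced_metric S u $ 2 $ 2 = page_metric (pmap S u) w w"
    by (simp_all add: induced_metric_def line)
qed

lemma quadratic_form_2:
  fixes A :: "real^2^2" and v :: "real^2"
  shows "v \<bullet> (A *v v) = A$1$1 * (v$1)^2 + (A$1$2 + A$2$1) * (v$1 * v$2) + A$2$2 * (v$2)^2"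
  by (simp add: inner_vec_def matrix_vector_mult_def sum_2 power2_eq_square algebra_simps)

lemma in_interior_rect:
  "u \<in> interior (rect a b c d) \<longleftrightarrow> a < u $ 1 \<and> u $ 1 < b \<and> c < u $ 2 \<and> u $ 2 < d"
  by (auto simp: rect_def interior_cbox mem_box_cart forall_2)

lemma positive_definite_2:
  fixes A :: "real^2^2"
  assumes "A$1$2 = A$2$1" "A$1$1 > 0" "A$1$1 * A$2$2 - A$1$2 * A$2$1 > 0" "v \<noteq> 0"
  shows "v \<bullet> (A *v v) > 0"
proof -
  let ?x = "A$1$1 * v$1 + A$1$2 * v$2"
  have *: "A$1$1 * (v \<bullet> (A *v v)) = ?x^2 + (A$1$1 * A$2$2 - A$1$2 * A$2$1) * (v$2)^2"
    by (simp add: quadratic_form_2 assms(1) power2_eq_square algebra_simps)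
  have "v$1 \<noteq> 0 \<or> v$2 \<noteq> 0" using \<open>v \<noteq> 0\<close> by (auto simp: vec_eq_iff forall_2)
  then have "?x^2 + (A$1$1 * A$2$2 - A$1$2 * A$2$1) * (v$2)^2 > 0"
    using assms by (cases "v$2 = 0") (auto intro: add_nonneg_pos)
  then show ?thesis
    using * assms(2) by (metis zero_less_mult_pos)
qed

section \<open>Metrics of revolution with rational coefficients\<close>

text \<open>The curvature of \<open>v(cos r) dr\<^sup>2 + \<Gamma>(cos r) dt\<^sup>2\<close>, expressed through derivatives in \<open>c = cos r\<close> and
  cleared of its main denominators. The sines occur only squared, so the right hand side is
  algebraic in \<open>c\<close>.\<close>

lemma gauss_curvature_revolution:
  fixes g :: "real^2 \<Rightarrow> real^2^2" and v \<Gamma> :: "real \<Rightarrow> real"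
  assumes g: "\<And>x. 0 < x $ 1 \<Longrightarrow> x $ 1 < pi \<Longrightarrow> g x $ 1 $ 1 = v (cos (x $ 1))"
      "\<And>x. g x $ 1 $ 2 = 0" "\<And>x. g x $ 2 $ 1 = 0"
      "\<And>x. 0 < x $ 1 \<Longrightarrow> x $ 1 < pi \<Longrightarrow> g x $ 2 $ 2 = \<Gamma> (cos (x $ 1))"
    and nz: "\<And>c. c \<in> {-1<..<1} \<Longrightarrow> v c \<noteq> 0" "\<And>c. c \<in> {-1<..<1} \<Longrightarrow> \<Gamma> c \<noteq> 0"
    and v1: "\<And>c. c \<in> {-1<..<1} \<Longrightarrow> (v has_real_derivative v1 c) (at c)"
    and \<Gamma>1: "\<And>c. c \<in> {-1<..<1} \<Longrightarrow> (\<Gamma> has_real_derivative \<Gamma>1 c) (at c)"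
    and \<Gamma>2: "\<And>c. c \<in> {-1<..<1} \<Longrightarrow> (\<Gamma>1 has_real_derivative \<Gamma>2 c) (at c)"
    and r: "0 < u $ 1" "u $ 1 < pi" and c: "c = cos (u $ 1)"
  shows "4 * (v c)^2 * (\<Gamma> c)^2 * gauss_curvature g u =
    - 2 * v c * \<Gamma> c * ((1 - c^2) * \<Gamma>2 c - c * \<Gamma>1 c)
    + (1 - c^2) * \<Gamma> c * \<Gamma>1 c * v1 c + (1 - c^2) * v c * (\<Gamma>1 c)^2"
proof -
  let ?U = "{x :: real^2. 0 < x $ 1 \<and> x $ 1 < pi}"
  have U: "open ?U" "u \<in> ?U"
    using r by (auto intro!: open_Collect_conj open_Collect_less continuous_intros)
  have cos: "cos r \<in> {-1<..<1}" if "0 < r" "r < pi" for r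
    using that cos_monotone_0_pi[of 0 r] cos_monotone_0_pi[of r pi] by auto
  have cx: "cos (x $ 1) \<in> {-1<..<1}" if "x \<in> ?U" for x :: "real^2"
    using cos that by blast
  have D: "((\<lambda>r. F (cos r)) has_real_derivative - sin r * F1 (cos r)) (at r)"
    if "0 < r" "r < pi" "\<And>c. c \<in> {-1<..<1} \<Longrightarrow> (F has_real_derivative F1 c) (at c)" for F F1 r
    by (rule DERIV_cong[OF DERIV_chain2[of F, OF that(3)[OF cos[OF that(1,2)]] DERIV_cos]]) simp
  have gU: "g x $ 1 $ 1 = v (cos (x $ 1))" "g x $ 2 $ 2 = \<Gamma> (cos (x $ 1))" if "x \<in> ?U" for x
    using that g by auto
  have partials: "has_partial (\<lambda>x. v (cos (x $ 1))) 1 (- sin (x $ 1) * v1 (cos (x $ 1))) x"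
    "has_partial (\<lambda>x. v (cos (x $ 1))) 2 0 x"
    "has_partial (\<lambda>x. \<Gamma> (cos (x $ 1))) 1 (- sin (x $ 1) * \<Gamma>1 (cos (x $ 1))) x"
    "has_partial (\<lambda>x. \<Gamma> (cos (x $ 1))) 2 0 x" if "x \<in> ?U" for x
    using that has_partial_coordinate[of "\<lambda>r. v (cos r)" _ x 1, OF D[OF _ _ v1]]
      has_partial_coordinate[of "\<lambda>r. \<Gamma> (cos r)" _ x 1, OF D[OF _ _ \<Gamma>1]]
      has_partial_other_coordinate[of 1 2 "\<lambda>r. v (cos r)" x]
      has_partial_other_coordinate[of 1 2 "\<lambda>r. \<Gamma> (cos r)" x]
    by auto
  \<comment> \<open>\<open>h11\<close> is the second derivative of \<open>\<Gamma> (cos r)\<close> in \<open>r\<close>\<close>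
  define h11 where "h11 = - c * \<Gamma>1 c + (1 - c^2) * \<Gamma>2 c"
  have h11: "has_partial (\<lambda>x. - sin (x $ 1) * \<Gamma>1 (cos (x $ 1))) 1 h11 u"
    by (rule has_partial_coordinate[where p = "\<lambda>r. - sin r * \<Gamma>1 (cos r)"],
        rule DERIV_cong[OF DERIV_mult[OF DERIV_minus[OF DERIV_sin] D[OF r \<Gamma>2]]])
      (auto simp: h11_def c sin_squared_eq[symmetric], simp add: power2_eq_square)
  have "gauss_curvature g u =
    (- 0 / (2 * v c) - h11 / (2 * v c)
     + (- sin (u $ 1) * \<Gamma>1 c) * (- sin (u $ 1) * v1 c) / (4 * (v c)^2) + 0^2 / (4 * (v c)^2)
     + 0 * 0 / (4 * v c * \<Gamma> c) + (- sin (u $ 1) * \<Gamma>1 c)^2 / (4 * v c * \<Gamma> c)) / \<Gamma> c"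
    unfolding c
    by (rule gauss_curvature_orthogonal[OF U, where e = "\<lambda>x. v (cos (x $ 1))"
          and h = "\<lambda>x. \<Gamma> (cos (x $ 1))" and ?e1.0 = "\<lambda>x. - sin (x $ 1) * v1 (cos (x $ 1))"
          and ?h1.0 = "\<lambda>x. - sin (x $ 1) * \<Gamma>1 (cos (x $ 1))"
          and ?h2.0 = "\<lambda>_. 0" and ?e2.0 = "\<lambda>_. 0"])
      (erule gU partials nz[OF cx] | rule g(2,3) h11[unfolded c] has_partial_const)+
  then have K: "gauss_curvature g u = (- h11 / (2 * v c)
     + (1 - c^2) * \<Gamma>1 c * v1 c / (4 * (v c)^2) + (1 - c^2) * (\<Gamma>1 c)^2 / (4 * v c * \<Gamma> c)) / \<Gamma> c"
    by (simp add: c power_mult_distrib sin_squared_eq flip: power2_eq_square mult.assoc)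
  have "v c \<noteq> 0" "\<Gamma> c \<noteq> 0" using nz cx[OF U(2)] c by auto
  then show ?thesis
    unfolding K h11_def by (simp add: c[symmetric] sin_squared_eq field_simps power2_eq_square)
qed

lemma poly_eq_0_if_zero_on_interval:
  fixes p :: "real poly"
  assumes "a < b" "\<And>c. c \<in> {a<..<b} \<Longrightarrow> poly p c = 0"
  shows "p = 0"
proof (rule ccontr)
  assume "p \<noteq> 0"
  then have "finite {c. poly p c = 0}" by (rule poly_roots_finite)
  moreover have "{a<..<b} \<subseteq> {c. poly p c = 0}" using assms(2) by blast
  ultimately show False using \<open>a < b\<close> by (meson finite_subset infinite_Ioo)
qed

text \<open>The situation to be refuted: a metric \<open>(P/Q) dr\<^sup>2 + \<Gamma> dt\<^sup>2\<close>, with \<open>P\<close>, \<open>Q\<close>, \<open>\<Gamma>\<close> evaluated at \<open>cos r\<close>,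
  has constant curvature \<open>k\<close>. One line \<open>t = y\<close> suffices, because the coefficients depend on \<open>r\<close>
  only.\<close>

locale constant_curvature_revolution =
  fixes g :: "real^2 \<Rightarrow> real^2^2" and P Q :: "real poly" and \<Gamma> :: "real \<Rightarrow> real"
    and k y :: real
  assumes g: "\<And>x. 0 < x $ 1 \<Longrightarrow> x $ 1 < pi \<Longrightarrow>
        g x $ 1 $ 1 = poly P (cos (x $ 1)) / poly Q (cos (x $ 1))"
      "\<And>x. g x $ 1 $ 2 = 0" "\<And>x. g x $ 2 $ 1 = 0"
      "\<And>x. 0 < x $ 1 \<Longrightarrow> x $ 1 < pi \<Longrightarrow> g x $ 2 $ 2 = \<Gamma> (cos (x $ 1))"
    and pos: "\<And>c. c \<in> {-1<..<1} \<Longrightarrow> poly P c > 0" "\<And>c. c \<in> {-1<..<1} \<Longrightarrow> poly Q c > 0"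
      "\<And>c. c \<in> {-1<..<1} \<Longrightarrow> \<Gamma> c > 0"
    and k: "\<And>x. 0 < x $ 1 \<Longrightarrow> x $ 1 < pi \<Longrightarrow> x $ 2 = y \<Longrightarrow> gauss_curvature g x = k"
begin

lemma curvature_equation:
  assumes "\<And>c. c \<in> {-1<..<1} \<Longrightarrow> (\<Gamma> has_real_derivative \<Gamma>1 c) (at c)"
    and "\<And>c. c \<in> {-1<..<1} \<Longrightarrow> (\<Gamma>1 has_real_derivative \<Gamma>2 c) (at c)"
    and c: "c \<in> {-1<..<1}"
  defines "p \<equiv> poly P c" and "q \<equiv> poly Q c" and "p1 \<equiv> poly (pderiv P) c" and "q1 \<equiv> poly (pderiv Q) c"
  shows "4 * (p / q)^2 * (\<Gamma> c)^2 * k =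
    - 2 * (p / q) * \<Gamma> c * ((1 - c^2) * \<Gamma>2 c - c * \<Gamma>1 c)
    + (1 - c^2) * \<Gamma> c * \<Gamma>1 c * ((p1 * q - p * q1) / q^2) + (1 - c^2) * (p / q) * (\<Gamma>1 c)^2"
proof -
  define u :: "real^2" where "u = vector [arccos c, y]"
  have u: "0 < u $ 1" "u $ 1 < pi" "u $ 2 = y" "c = cos (u $ 1)"
    using c arccos_lt_bounded[of c] by (auto simp: u_def cos_arccos)
  have V: "((\<lambda>c. poly P c / poly Q c) has_real_derivative
      (poly (pderiv P) c * poly Q c - poly P c * poly (pderiv Q) c) / (poly Q c)^2) (at c)"
    if "c \<in> {-1<..<1}" for c
    using pos(2)[OF that] by (intro DERIV_cong[OF DERIV_divide[OF poly_DERIV poly_DERIV]])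
      (auto simp: power2_eq_square)
  show ?thesis
    using gauss_curvature_revolution[OF g _ _ V assms(1,2) u(1,2,4)] k[OF u(1-3)] pos
    unfolding p_def q_def p1_def q1_def by (simp add: less_imp_neq[symmetric])
qed

text \<open>pole\<close>
text \<open>Let \<open>\<Gamma> = G/P\<close>, and let \<open>z\<close> be a simple zero of \<open>P\<close>. If \<open>G z \<noteq> 0\<close>, the derivative terms of the
  curvature equation have a pole of order 3 at \<open>z\<close>, while \<open>4 (P/Q)\<^sup>2 \<Gamma>\<^sup>2 k\<close> is regular there. As only polynomials are involved,
  this is carried out by multiplying the equation with \<open>P\<^sup>3 Q\<^sup>2\<close> and evaluating at \<open>z\<close>: what
  survives adds up to \<open>4 G\<^sup>2 Q (1 - z\<^sup>2) P'\<^sup>2\<close>, up to sign.\<close>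

lemma warping_numerator_vanishes:
  assumes G: "\<And>c. c \<in> {-1<..<1} \<Longrightarrow> \<Gamma> c = poly G c / poly P c"
    and z: "poly P z = 0" "poly (pderiv P) z \<noteq> 0" "poly Q z \<noteq> 0" "z^2 \<noteq> 1"
  shows "poly G z = 0"
proof -
  define D1 where "D1 = pderiv G * P - G * pderiv P"
  define D2 where "D2 = pderiv D1 * P - 2 * pderiv P * D1"
  define S :: "real poly" where "S = [:1, 0, -1:]"
  define X :: "real poly" where "X = [:0, 1:]"
  define R where "R = smult (4 * k) (G^2 * P^3) + 2 * G * Q * (S * D2 - X * P * D1)
     - S * G * D1 * (pderiv P * Q - P * pderiv Q) - S * Q * D1^2"
  have "poly R c = 0" if c: "c \<in> {-1<..<1}" for c
  proof -
    have d1: "(\<Gamma> has_real_derivative poly D1 c / (poly P c)^2) (at c)" if "c \<in> {-1<..<1}" for c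
    proof -
      have "((\<lambda>c. poly G c / poly P c) has_real_derivative poly D1 c / (poly P c)^2) (at c)"
        using pos(1)[OF that] by (intro DERIV_cong[OF DERIV_divide[OF poly_DERIV poly_DERIV]])
          (auto simp: power2_eq_square D1_def)
      then show ?thesis
        by (rule has_field_derivative_transform_within_open[of _ _ _ "{-1<..<1}"]) (use that G in auto)
    qed
    have d2: "((\<lambda>c. poly D1 c / (poly P c)^2) has_real_derivative poly D2 c / (poly P c)^3) (at c)"
      if "c \<in> {-1<..<1}" for c
      using pos(1)[OF that]
      by (intro DERIV_cong[OF DERIV_divide[OF poly_DERIV DERIV_power[OF poly_DERIV]]])
        (auto simp: divide_simps D2_def, simp add: power2_eq_square power3_eq_cube power4_eq_xxxx algebra_simps)
    have clear: "4 * g^2 * p^3 * k + 2 * g * q * (s * d2 - c * p * d1)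
        - s * g * d1 * (p1 * q - p * q1) - s * q * d1^2 = 0"
      if "4 * (p / q)^2 * (g / p)^2 * k = - 2 * (p / q) * (g / p) * (s * (d2 / p^3) - c * (d1 / p^2))
        + s * (g / p) * (d1 / p^2) * ((p1 * q - p * q1) / q^2) + s * (p / q) * (d1 / p^2)^2"
        "p > 0" "q > 0" for p q g d1 d2 p1 q1 s :: real
    proof -
      have "4 * (p / q)^2 * (g / p)^2 * k * (p^3 * q^2) = 4 * g^2 * p^3 * k"
        using that(2,3) by (simp add: power_divide)
      moreover have "(- 2 * (p / q) * (g / p) * (s * (d2 / p^3) - c * (d1 / p^2))
        + s * (g / p) * (d1 / p^2) * ((p1 * q - p * q1) / q^2) + s * (p / q) * (d1 / p^2)^2) * (p^3 * q^2)
        = - 2 * g * q * (s * d2 - c * p * d1) + s * g * d1 * (p1 * q - p * q1) + s * q * d1^2"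
        using that(2,3) by (simp add: field_simps power2_eq_square power3_eq_cube)
      ultimately have "4 * g^2 * p^3 * k
          = - 2 * g * q * (s * d2 - c * p * d1) + s * g * d1 * (p1 * q - p * q1) + s * q * d1^2"
        by (simp only: that(1))
      then show ?thesis by (simp add: algebra_simps)
    qed
    show ?thesis
      using clear[OF curvature_equation[OF d1 d2 c, unfolded G[OF c]] pos(1,2)[OF c]]
      by (simp add: R_def S_def X_def power2_eq_square algebra_simps)
  qed
  then have "poly R z = 0"
    using poly_eq_0_if_zero_on_interval[of "-1" 1 R] by simp
  moreover have "poly R z = 4 * (poly G z)^2 * poly Q z * (1 - z^2) * (poly (pderiv P) z)^2"
    using z(1) by (simp add: R_def S_def X_def D1_def D2_def power2_eq_square algebra_simps)
  ultimately show ?thesis using z by simp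
qed

text \<open>When \<open>\<Gamma>\<close> is a multiple of \<open>P\<close>, the previous lemma says nothing, for then \<open>G = l P\<^sup>2\<close> vanishes at \<open>z\<close>.
  But now a factor \<open>l\<^sup>2 P\<close> can be cancelled from the equation on the interval, where \<open>P\<close> is positive,
  and what remains is nonzero at \<open>z\<close>.\<close>

lemma warping_not_proportional:
  assumes G: "\<And>c. c \<in> {-1<..<1} \<Longrightarrow> \<Gamma> c = l * poly P c"
    and z: "poly P z = 0" "poly (pderiv P) z \<noteq> 0" "poly Q z \<noteq> 0" "z^2 \<noteq> 1"
  shows False
proof -
  define S :: "real poly" where "S = [:1, 0, -1:]"
  define X :: "real poly" where "X = [:0, 1:]"
  define R where "R = smult (4 * k) (P^3)
     + 2 * P * Q * (S * pderiv (pderiv P) - X * pderiv P)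
     - S * pderiv P * (2 * pderiv P * Q - P * pderiv Q)"
  have "l > 0" using G[of 0] pos(1,3)[of 0] by (auto simp: zero_less_mult_iff)
  have "poly R c = 0" if c: "c \<in> {-1<..<1}" for c
  proof -
    have d1: "(\<Gamma> has_real_derivative l * poly (pderiv P) c) (at c)" if "c \<in> {-1<..<1}" for c
      by (rule has_field_derivative_transform_within_open[OF DERIV_cmult[OF poly_DERIV], of "{-1<..<1}"])
        (use that G in auto)
    have clear: "4 * p^3 * k + 2 * p * q * (s * p2 - c * p1) - s * p1 * (2 * p1 * q - p * q1) = 0"
      if "4 * (p / q)^2 * (l * p)^2 * k = - 2 * (p / q) * (l * p) * (s * (l * p2) - c * (l * p1))
        + s * (l * p) * (l * p1) * ((p1 * q - p * q1) / q^2) + s * (p / q) * (l * p1)^2"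
        "p > 0" "q > 0" for p q p1 p2 q1 s :: real
    proof -
      have "4 * (p / q)^2 * (l * p)^2 * k * q^2 = l^2 * p * (4 * p^3 * k)"
        using that(2,3) by (simp add: field_simps power2_eq_square power3_eq_cube)
      moreover have "(- 2 * (p / q) * (l * p) * (s * (l * p2) - c * (l * p1))
        + s * (l * p) * (l * p1) * ((p1 * q - p * q1) / q^2) + s * (p / q) * (l * p1)^2) * q^2
        = l^2 * p * (- 2 * p * q * (s * p2 - c * p1) + s * p1 * (2 * p1 * q - p * q1))"
        using that(2,3) by (simp add: field_simps power2_eq_square)
      ultimately have "l^2 * p * (4 * p^3 * k)
        = l^2 * p * (- 2 * p * q * (s * p2 - c * p1) + s * p1 * (2 * p1 * q - p * q1))"
        using that(1) by simp
      then show ?thesis using \<open>l > 0\<close> \<open>p > 0\<close> by simp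
    qed
    show ?thesis
      using clear[OF curvature_equation[OF d1 DERIV_cmult[OF poly_DERIV] c, unfolded G[OF c]] pos(1,2)[OF c]]
      by (simp add: R_def S_def X_def power2_eq_square algebra_simps)
  qed
  then have "poly R z = 0"
    using poly_eq_0_if_zero_on_interval[of "-1" 1 R] by simp
  moreover have "poly R z = - 2 * (1 - z^2) * (poly (pderiv P) z)^2 * poly Q z"
    using z(1) by (simp add: R_def S_def X_def power2_eq_square algebra_simps)
  ultimately show ?thesis using z by simp
qed

end

section \<open>Curvature of the six families\<close>

abbreviation S1_surface :: "real \<Rightarrow> real \<Rightarrow> surface" where
  "S1_surface r \<theta> \<equiv> \<lparr>pdom = rect 0 (4 * pi) 0 (2 * pi), pmap = (\<lambda>u. (r, \<theta>, u$2, u$1))\<rparr>"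

abbreviation S2_surface :: "real \<Rightarrow> real \<Rightarrow> surface" where
  "S2_surface \<phi> \<psi> \<equiv> \<lparr>pdom = rect 0 pi 0 pi, pmap = (\<lambda>u. (u$1, u$2, \<phi>, \<psi>))\<rparr>"

abbreviation S3_surface :: "real \<Rightarrow> real \<Rightarrow> surface" where
  "S3_surface r \<phi> \<equiv> \<lparr>pdom = rect 0 (4 * pi) 0 (2 * pi), pmap = (\<lambda>u. (r, u$2, \<phi>, u$1))\<rparr>"

abbreviation S4_surface :: "real \<Rightarrow> real \<Rightarrow> surface" where
  "S4_surface \<theta> \<psi> \<equiv> \<lparr>pdom = rect 0 pi 0 (2 * pi), pmap = (\<lambda>u. (u$1, \<theta>, u$2, \<psi>))\<rparr>"

abbreviation S5_surface :: "real \<Rightarrow> real \<Rightarrow> surface" where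
  "S5_surface \<theta> \<phi> \<equiv> \<lparr>pdom = rect 0 pi 0 (4 * pi), pmap = (\<lambda>u. (u$1, \<theta>, \<phi>, u$2))\<rparr>"

lemma const_curvature_imp_positive:
  fixes v :: "real^2"
  assumes "const_curvature S k" "u \<in> interior (pdom S)" "v \<noteq> 0"
  shows "induced_metric S u $1$1 * (v$1)^2
    + (induced_metric S u $1$2 + induced_metric S u $2$1) * (v$1 * v$2)
    + induced_metric S u $2$2 * (v$2)^2 > 0"
  using assms by (auto simp: const_curvature_def quadratic_form_2)

text \<open>The common obstruction for \<open>S2\<close>, \<open>S4\<close> and \<open>S5\<close>, applied at the zero \<open>1/a\<close> of \<open>P\<close>. The term with \<open>h\<close> has
  a pole there and decides the matter if \<open>\<beta> \<noteq> 0\<close>; otherwise the warping function is a multiple of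
  \<open>P\<close>.\<close>

lemma radial_metric_not_constant_curvature:
  assumes g: "\<And>x. g x $ 1 $ 1 = page_V (x $ 1)"
      "\<And>x. g x $ 1 $ 2 = 0" "\<And>x. g x $ 2 $ 1 = 0"
      "\<And>x. g x $ 2 $ 2 = \<alpha> * page_f (x $ 1) + \<beta> * page_h (x $ 1)"
    and nonneg: "0 \<le> \<alpha>" "0 \<le> \<beta>" "\<alpha> \<noteq> 0 \<or> \<beta> \<noteq> 0"
    and k: "\<And>x. 0 < x $ 1 \<Longrightarrow> x $ 1 < pi \<Longrightarrow> x $ 2 = y \<Longrightarrow> gauss_curvature g x = k"
  shows False
proof -
  define G where "G = smult (4 * \<alpha> / page_N) (page_P^2) + smult (\<beta> * page_C) ([:1, 0, -1:] * page_Q)"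
  define \<Gamma> where "\<Gamma> c = poly G c / poly page_P c" for c
  have sq: "c^2 < 1" if "c \<in> {-1<..<1}" for c :: real
    using that by (simp add: abs_square_less_1 abs_less_iff)
  have P: "poly page_P c > 0" "poly page_Q c > 0" if "c \<in> {-1<..<1}" for c
    using page_poly_pos sq[OF that] by auto
  have \<Gamma>: "\<alpha> * page_f r + \<beta> * page_h r = \<Gamma> (cos r)" for r
  proof -
    have "poly page_P (cos r) > 0" by (simp add: page_poly_pos abs_square_le_1)
    then show ?thesis
      by (simp add: page_f_eq page_h_eq \<Gamma>_def G_def field_simps power2_eq_square)
  qed
  have "\<Gamma> c > 0" if c: "c \<in> {-1<..<1}" for c
  proof -
    have r: "0 < arccos c" "arccos c < pi" "cos (arccos c) = c"
      using c arccos_lt_bounded[of c] by (auto simp: cos_arccos)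
    show ?thesis
      using nonneg page_f_pos page_h_pos[OF r(1,2)] \<Gamma>[of "arccos c"] r(3)
      by (metis add_nonneg_pos add_pos_nonneg less_eq_real_def mult_nonneg_nonneg mult_pos_pos)
  qed
  then interpret constant_curvature_revolution g page_P page_Q \<Gamma> k y
    by unfold_locales (auto simp: g \<Gamma> page_V_eq P k)
  \<comment> \<open>the positive zero of \<open>page_P\<close>\<close>
  define z where "z = 1 / page_a"
  note a = page_a_bounds page_a_square
  have az: "page_a^2 * z^2 = 1" using a by (simp add: z_def power_divide)
  have z: "poly page_P z = 0" "poly (pderiv page_P) z \<noteq> 0" "poly page_Q z \<noteq> 0" "z^2 \<noteq> 1"
  proof -
    show "poly page_P z = 0" using az by (simp add: page_P_def power2_eq_square algebra_simps)
    show "poly (pderiv page_P) z \<noteq> 0" using a by (simp add: page_P_def pderiv_pCons z_def)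
    have "poly page_Q z = 3 - page_a^2 - (1 + page_a^2) * (page_a^2 * z^2)"
      by (simp add: page_Q_def power2_eq_square algebra_simps)
    then show "poly page_Q z \<noteq> 0" using a by (simp add: az)
    show "z^2 \<noteq> 1" using az a by auto
  qed
  show False
  proof (cases "\<beta> = 0")
    case True
    have "\<Gamma> c = 4 * \<alpha> / page_N * poly page_P c" if "c \<in> {-1<..<1}" for c
      using P(1)[OF that] True by (simp add: \<Gamma>_def G_def power2_eq_square)
    then show False by (rule warping_not_proportional[OF _ z])
  next
    case False
    have "poly G z = 0" by (rule warping_numerator_vanishes[OF _ z]) (simp add: \<Gamma>_def)
    moreover have "poly G z = \<beta> * page_C * (1 - z^2) * poly page_Q z"
      using z(1) by (simp add: G_def power2_eq_square algebra_simps)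
    ultimately show False using False page_C_pos z by simp
  qed
qed

lemma S2_not_constant_curvature: "\<not> const_curvature (S2_surface \<phi> \<psi>) k"
proof
  let ?S = "S2_surface \<phi> \<psi>"
  assume k: "const_curvature ?S k"
  note g = induced_metric_affine[of ?S "(0, 0, \<phi>, \<psi>)" "(1, 0, 0, 0)" "(0, 1, 0, 0)", simplified,
      unfolded page_metric_coordinates]
  show False
    by (rule radial_metric_not_constant_curvature[of "induced_metric ?S" "1/4" 0 "pi/2" k])
      (use k in \<open>auto simp: g const_curvature_def in_interior_rect\<close>)
qed

lemma S4_not_constant_curvature: "\<not> const_curvature (S4_surface \<theta> \<psi>) k"
proof
  let ?S = "S4_surface \<theta> \<psi>"
  assume k: "const_curvature ?S k"
  note g = induced_metric_affine[of ?S "(0, \<theta>, 0, \<psi>)" "(1, 0, 0, 0)" "(0, 0, 1, 0)", simplified,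
      unfolded page_metric_coordinates]
  have nz: "(sin \<theta>)^2 / 4 \<noteq> 0 \<or> (cos \<theta>)^2 / 4 \<noteq> 0"
    using sin_zero_abs_cos_one[of \<theta>] by auto
  show False
    by (rule radial_metric_not_constant_curvature[OF _ _ _ _ _ _ nz,
          of "induced_metric ?S" pi k])
      (use k in \<open>auto simp: g const_curvature_def in_interior_rect power2_eq_square
        mult.commute[of "page_f _"] mult.commute[of "page_h _"]\<close>)
qed

lemma S5_not_constant_curvature: "\<not> const_curvature (S5_surface \<theta> \<phi>) k"
proof
  let ?S = "S5_surface \<theta> \<phi>"
  assume k: "const_curvature ?S k"
  note g = induced_metric_affine[of ?S "(0, \<theta>, \<phi>, 0)" "(1, 0, 0, 0)" "(0, 0, 0, 1)", simplified,
      unfolded page_metric_coordinates]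
  show False
    by (rule radial_metric_not_constant_curvature[of "induced_metric ?S" 0 "1/4" pi k])
      (use k in \<open>auto simp: g const_curvature_def in_interior_rect\<close>)
qed

lemma S1_metric:
  "induced_metric (S1_surface r \<theta>) u $ 1 $ 1 = page_h r / 4"
  "induced_metric (S1_surface r \<theta>) u $ 1 $ 2 = page_h r * cos \<theta> / 4"
  "induced_metric (S1_surface r \<theta>) u $ 2 $ 1 = page_h r * cos \<theta> / 4"
  "induced_metric (S1_surface r \<theta>) u $ 2 $ 2 = (page_f r * (sin \<theta>)^2 + page_h r * (cos \<theta>)^2) / 4"
  using induced_metric_affine[of "S1_surface r \<theta>" "(r, \<theta>, 0, 0)" "(0, 0, 0, 1)" "(0, 0, 1, 0)" u, simplified,
      unfolded page_metric_coordinates]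
  by (simp_all add: power2_eq_square algebra_simps)

lemma S3_metric:
  "induced_metric (S3_surface r \<phi>) u $ 1 $ 1 = page_h r / 4"
  "induced_metric (S3_surface r \<phi>) u $ 1 $ 2 = 0"
  "induced_metric (S3_surface r \<phi>) u $ 2 $ 1 = 0"
  "induced_metric (S3_surface r \<phi>) u $ 2 $ 2 = page_f r / 4"
  using induced_metric_affine[of "S3_surface r \<phi>" "(r, 0, \<phi>, 0)" "(0, 0, 0, 1)" "(0, 1, 0, 0)" u, simplified,
      unfolded page_metric_coordinates]
  by simp_all

lemma S6_metric:
  "induced_metric (S6_surface r \<psi>) u $ 1 $ 1
     = (page_f r * (sin (u $ 2))^2 + page_h r * (cos (u $ 2))^2) / 4"
  "induced_metric (S6_surface r \<psi>) u $ 1 $ 2 = 0"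
  "induced_metric (S6_surface r \<psi>) u $ 2 $ 1 = 0"
  "induced_metric (S6_surface r \<psi>) u $ 2 $ 2 = page_f r / 4"
  using induced_metric_affine[of "S6_surface r \<psi>" "(r, 0, 0, \<psi>)" "(0, 0, 1, 0)" "(0, 1, 0, 0)" u,
      simplified S6_surface_def, simplified, unfolded page_metric_coordinates]
  by (simp_all add: power2_eq_square algebra_simps S6_surface_def)

lemma flat_if_constant_metric:
  assumes "\<And>u i j. induced_metric S u $ i $ j = A $ i $ j"
    and "A$1$2 = A$2$1" "A$1$1 > 0" "A$1$1 * A$2$2 - A$1$2 * A$2$1 > 0"
  shows "flat S"
proof -
  have "induced_metric S = (\<lambda>_. A)" using assms(1) by (auto simp: vec_eq_iff)
  then show ?thesis
    using positive_definite_2[OF assms(2-)]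
    by (simp add: flat_def const_curvature_def gauss_curvature_constant_metric)
qed

lemma S1_flat:
  assumes "0 < r" "r < pi" "sin \<theta> \<noteq> 0"
  shows "flat (S1_surface r \<theta>)"
proof (rule flat_if_constant_metric)
  let ?A = "induced_metric (S1_surface r \<theta>) 0"
  show "induced_metric (S1_surface r \<theta>) u $ i $ j = ?A $ i $ j" for u i j
    using exhaust_2[of i] exhaust_2[of j] by (auto simp: S1_metric)
  have det: "?A$1$1 * ?A$2$2 - ?A$1$2 * ?A$2$1 = page_h r * page_f r * (sin \<theta>)^2 / 16"
    unfolding S1_metric by (simp add: power2_eq_square field_simps)
  show "?A$1$1 * ?A$2$2 - ?A$1$2 * ?A$2$1 > 0"
    unfolding det using assms page_h_pos[of r] page_f_pos[of r] by simp
qed (use assms in \<open>simp_all add: S1_metric page_h_pos\<close>)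

lemma S3_flat:
  assumes "0 < r" "r < pi"
  shows "flat (S3_surface r \<phi>)"
proof (rule flat_if_constant_metric)
  let ?A = "induced_metric (S3_surface r \<phi>) 0"
  show "induced_metric (S3_surface r \<phi>) u $ i $ j = ?A $ i $ j" for u i j
    using exhaust_2[of i] exhaust_2[of j] by (auto simp: S3_metric)
qed (use assms in \<open>simp_all add: S3_metric page_h_pos page_f_pos\<close>)

text \<open>If \<open>sin \<theta> = 0\<close>, the two coordinate directions on \<open>S1\<close> are parallel, both tangent to the Hopf circle:
  the vector with components \<open>- cos \<theta>\<close> and \<open>1\<close> has length zero.\<close>

lemma S1_nondegenerate:
  assumes k: "const_curvature (S1_surface r \<theta>) k"
  shows "sin \<theta> \<noteq> 0"
proof
  assume "sin \<theta> = 0"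
  define u :: "real^2" where "u = vector [pi, pi]"
  \<comment> \<open>a null vector of the degenerate metric\<close>
  define v :: "real^2" where "v = vector [- cos \<theta>, 1]"
  have "u \<in> interior (pdom (S1_surface r \<theta>))" by (simp add: in_interior_rect u_def)
  moreover have "v \<noteq> 0" by (auto simp: v_def vec_eq_iff forall_2)
  ultimately show False
    using const_curvature_imp_positive[OF k, of u v, unfolded S1_metric] \<open>sin \<theta> = 0\<close>
    by (simp add: v_def power2_eq_square algebra_simps)
qed

lemma S3_nondegenerate:
  assumes k: "const_curvature (S3_surface r \<phi>) k"
  shows "r \<notin> {0, pi}"
proof
  assume "r \<in> {0, pi}"
  define u :: "real^2" where "u = vector [pi, pi]"
  have "u \<in> interior (pdom (S3_surface r \<phi>))" by (simp add: in_interior_rect u_def)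
  moreover have "axis 1 1 \<noteq> (0 :: real^2)" by simp
  ultimately show False
    using const_curvature_imp_positive[OF k, of u "axis 1 1"] page_h_ends[OF \<open>r \<in> {0, pi}\<close>]
    by (simp add: S3_metric axis_def)
qed

text \<open>Curvature of \<open>E d\<phi>\<^sup>2 + A d\<theta>\<^sup>2\<close> with \<open>E = A sin\<^sup>2 \<theta> + B cos\<^sup>2 \<theta>\<close>. The factor \<open>A - B\<close> comes from
  \<open>E' = 2 (A - B) sin \<theta> cos \<theta>\<close>.\<close>

lemma S6_gauss_curvature:
  fixes r \<psi> :: real and u :: "real^2"
  defines "A \<equiv> page_f r / 4" and "B \<equiv> page_h r / 4" and "\<theta> \<equiv> u $ 2"
  assumes \<theta>: "0 < \<theta>" "\<theta> < pi"
  shows "A * (A * (sin \<theta>)^2 + B * (cos \<theta>)^2)^2 * gauss_curvature (induced_metric (S6_surface r \<psi>)) u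
     = (A - B) * (A * (sin \<theta>)^4 - B * (cos \<theta>)^4)"
proof -
  let ?U = "{x :: real^2. 0 < x $ 2 \<and> x $ 2 < pi}"
  define E where "E \<theta> = A * (sin \<theta>)^2 + B * (cos \<theta>)^2" for \<theta>
  define E1 where "E1 \<theta> = 2 * (A - B) * (sin \<theta> * cos \<theta>)" for \<theta>
  define E2 where "E2 = 2 * (A - B) * ((cos \<theta>)^2 - (sin \<theta>)^2)"
  have U: "open ?U" "u \<in> ?U"
    using \<theta> by (auto intro!: open_Collect_conj open_Collect_less continuous_intros simp: \<theta>_def)
  have A: "A > 0" and B: "B \<ge> 0"
    using page_f_pos page_h_nonneg by (auto simp: A_def B_def)
  have E_pos: "E (x $ 2) > 0" if "x \<in> ?U" for x :: "real^2"
    using A B sin_gt_zero[of "x $ 2"] that by (auto simp: E_def intro!: add_pos_nonneg)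
  have D: "(E has_real_derivative E1 \<theta>) (at \<theta>)" for \<theta>
    unfolding E_def[abs_def] E1_def
    by (auto intro!: derivative_eq_intros simp: algebra_simps)
  have D2: "(E1 has_real_derivative E2) (at \<theta>)"
    unfolding E1_def[abs_def] E2_def
    by (auto intro!: derivative_eq_intros simp: algebra_simps power2_eq_square)
  have g: "induced_metric (S6_surface r \<psi>) x $ 1 $ 1 = E (x $ 2)"
    "induced_metric (S6_surface r \<psi>) x $ 2 $ 2 = A" for x
    by (simp_all add: S6_metric E_def A_def B_def field_simps)
  have "gauss_curvature (induced_metric (S6_surface r \<psi>)) u =
    (- E2 / (2 * E (u $ 2)) - 0 / (2 * E (u $ 2)) + 0 * 0 / (4 * (E (u $ 2))^2) + (E1 (u $ 2))^2 / (4 * (E (u $ 2))^2)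
     + 0 * E1 (u $ 2) / (4 * E (u $ 2) * A) + 0^2 / (4 * E (u $ 2) * A)) / A"
    by (rule gauss_curvature_orthogonal[OF U, where e = "\<lambda>x. E (x $ 2)" and h = "\<lambda>_. A"
          and ?e2.0 = "\<lambda>x. E1 (x $ 2)" and ?e1.0 = "\<lambda>_. 0" and ?h2.0 = "\<lambda>_. 0" and ?h1.0 = "\<lambda>_. 0"])
      (rule g S6_metric A[THEN less_imp_neq, symmetric] has_partial_const has_partial_coordinate D D2[unfolded \<theta>_def]
        has_partial_other_coordinate | drule E_pos | simp)+
  then have K: "gauss_curvature (induced_metric (S6_surface r \<psi>)) u
      = (E1 \<theta>^2 - 2 * E2 * E \<theta>) / (4 * A * (E \<theta>)^2)"
    using E_pos[OF U(2)] A by (simp add: \<theta>_def field_simps power2_eq_square)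
  have "4 * A * (E \<theta>)^2 * gauss_curvature (induced_metric (S6_surface r \<psi>)) u = E1 \<theta>^2 - 2 * E2 * E \<theta>"
    using E_pos[OF U(2)] A by (simp add: K \<theta>_def)
  also have "\<dots> = 4 * ((A - B) * (A * (sin \<theta>)^4 - B * (cos \<theta>)^4))"
    by (simp add: E1_def E2_def E_def algebra_simps power2_eq_square power4_eq_xxxx)
  finally show ?thesis by (simp add: E_def)
qed

text \<open>Here \<open>B = 0\<close>, which leaves the round metric \<open>A (sin\<^sup>2 \<theta> d\<phi>\<^sup>2 + d\<theta>\<^sup>2)\<close>.\<close>

lemma S6_end_const_curvature:
  assumes "r \<in> {0, pi}"
  shows "const_curvature (S6_surface r \<psi>) (4 / page_f r)"
  unfolding const_curvature_def
proof (intro ballI conjI allI impI)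
  fix u assume "u \<in> interior (pdom (S6_surface r \<psi>))"
  then have u: "0 < u $ 2" "u $ 2 < pi" by (auto simp: S6_surface_def in_interior_rect)
  note f = page_f_pos[of r] and h = page_h_ends[OF assms]
  have s: "sin (u $ 2) > 0" using u by (rule sin_gt_zero)
  show "v \<bullet> (induced_metric (S6_surface r \<psi>) u *v v) > 0" if "v \<noteq> 0" for v
    by (rule positive_definite_2) (use that f s in \<open>simp_all add: S6_metric h\<close>)
  show "gauss_curvature (induced_metric (S6_surface r \<psi>)) u = 4 / page_f r"
    using S6_gauss_curvature[OF u, of r \<psi>] f s
    by (simp add: h field_simps power2_eq_square power4_eq_xxxx)
qed

text \<open>Two values of \<open>\<theta>\<close> decide. At \<open>\<pi>/2\<close> the curvature is \<open>(A - B)/A\<^sup>2\<close>, at \<open>\<pi>/4\<close> it is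
  \<open>(A - B)\<^sup>2/(A (A + B)\<^sup>2)\<close>; if they agree and \<open>A \<noteq> B\<close>, then \<open>3 A B + B\<^sup>2 = 0\<close>, impossible for positive
  \<open>A\<close> and \<open>B\<close>.\<close>

lemma S6_regular_const_curvature_imp_flat:
  assumes r: "0 < r" "r < pi" and k: "const_curvature (S6_surface r \<psi>) k"
  shows "page_f r = page_h r" "flat (S6_surface r \<psi>)"
proof -
  define A B where "A = page_f r / 4" and "B = page_h r / 4"
  have A: "A > 0" and B: "B > 0"
    using page_f_pos page_h_pos[OF r] by (auto simp: A_def B_def)
  have K: "A * (A * (sin \<theta>)^2 + B * (cos \<theta>)^2)^2 * k = (A - B) * (A * (sin \<theta>)^4 - B * (cos \<theta>)^4)"
    if "0 < \<theta>" "\<theta> < pi" for \<theta>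
  proof -
    define u :: "real^2" where "u = vector [pi, \<theta>]"
    have "u \<in> interior (pdom (S6_surface r \<psi>))"
      using that by (simp add: in_interior_rect u_def S6_surface_def)
    then have "gauss_curvature (induced_metric (S6_surface r \<psi>)) u = k"
      using k by (simp add: const_curvature_def)
    then show ?thesis
      using S6_gauss_curvature[of u r \<psi>] that by (simp add: u_def A_def B_def)
  qed
  have K2: "A^2 * k = A - B"
    using K[of "pi/2"] A by (simp add: power2_eq_square)
  have sc: "(sin (pi/4))^2 = (1/2 :: real)" "(cos (pi/4))^2 = (1/2 :: real)"
    by (simp_all add: sin_45 cos_45 power_divide)
  have pow4: "x^4 = x^2 * x^2" for x :: real by (simp flip: power_add)
  have sc4: "(sin (pi/4))^4 = (1/4 :: real)" "(cos (pi/4))^4 = (1/4 :: real)"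
    unfolding pow4 sc by simp_all
  have K4: "A * (A + B)^2 * k = (A - B)^2"
    using K[of "pi/4", unfolded sc sc4] by (simp add: field_simps power2_eq_square)
  have "(A - B) * ((A + B)^2 - A * (A - B)) = 0"
    using K2 K4 by algebra
  moreover have "(A + B)^2 - A * (A - B) = 3 * A * B + B^2"
    by (simp add: power2_eq_square algebra_simps)
  moreover have "3 * A * B + B^2 > 0" using A B by (intro add_pos_pos) auto
  ultimately have "A = B" by simp
  then show "page_f r = page_h r" by (simp add: A_def B_def)
  have "k = 0" using K2 \<open>A = B\<close> A by simp
  then show "flat (S6_surface r \<psi>)" using k by (simp add: flat_def)
qed

section \<open>Slices of the Page space\<close>

lemma homeomorphic_space_top_of_set:
  "top_of_set S homeomorphic_space top_of_set T \<longleftrightarrow> S homeomorphic T"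
proof -
  have "homeomorphic_maps (top_of_set S) (top_of_set T) f g \<longleftrightarrow> homeomorphism S T f g" for f g
    by (force simp: Pi_iff homeomorphic_maps_def homeomorphism_def)
  then show ?thesis by (simp add: homeomorphic_def homeomorphic_space_def)
qed

text \<open>Stated with projections, so that points of the 3-sphere need not be split into coordinates.\<close>

lemma page_rel_iff:
  "(p, p') \<in> page_rel \<longleftrightarrow> p \<in> page_dom \<and> p' \<in> page_dom \<and> snd p = snd p' \<and>
     (fst p = fst p' \<or> snd p \<in> {0, pi} \<and> hopf (fst p) = hopf (fst p'))"
  by (cases p, cases p') (simp only: page_rel_def mem_Collect_eq case_prod_conv fst_conv snd_conv)

lemma equiv_page_rel: "equiv page_dom page_rel"
proof (rule equivI)
  show "page_rel \<subseteq> page_dom \<times> page_dom" by (rule subrelI) (simp only: page_rel_iff mem_Sigma_iff)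
  show "refl_on page_dom page_rel" by (rule refl_onI) (simp only: page_rel_iff simp_thms)
  show "sym page_rel" by (rule symI) (simp only: page_rel_iff, metis)
  show "trans page_rel" by (rule transI) (simp only: page_rel_iff, metis)
qed

lemma page_proj_eq_iff:
  "p \<in> page_dom \<Longrightarrow> p' \<in> page_dom \<Longrightarrow> page_proj p = page_proj p' \<longleftrightarrow> (p, p') \<in> page_rel"
  unfolding page_proj_def by (rule eq_equiv_class_iff[OF equiv_page_rel])

text \<open>On a compact saturated set \<open>X\<close> the projection is still a quotient map. If \<open>q\<close> separates exactly the
  classes of \<open>X\<close>, it therefore factors through a continuous bijection from the compact image of \<open>X\<close> to
  the Hausdorff space \<open>q ` X\<close>, which must be a homeomorphism. This avoids showing that the Page space
  itself is Hausdorff.\<close>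

lemma page_image_homeomorphic:
  fixes q :: "R4 \<times> real \<Rightarrow> 'b::metric_space"
  assumes X: "compact X" "X \<subseteq> page_dom"
    and sat: "\<And>p p'. p \<in> X \<Longrightarrow> (p, p') \<in> page_rel \<Longrightarrow> p' \<in> X"
    and q: "continuous_on X q" "\<And>p p'. p \<in> X \<Longrightarrow> p' \<in> X \<Longrightarrow> q p = q p' \<longleftrightarrow> (p, p') \<in> page_rel"
  shows "subtopology page_space (page_proj ` X) homeomorphic_space top_of_set (q ` X)"
proof -
  let ?Y = "subtopology page_space (page_proj ` X)"
  have pre: "{p \<in> topspace (top_of_set page_dom). page_proj p \<in> page_proj ` X} = X"
  proof -
    have "p \<in> X" if "p \<in> page_dom" "page_proj p = page_proj p'" "p' \<in> X" for p p'
      using that X(2) sat page_proj_eq_iff[of p' p] by (metis subsetD)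
    then show ?thesis using X(2) unfolding topspace_euclidean_subtopology by blast
  qed
  have Y: "topspace ?Y = page_proj ` X"
    using X(2) page_proj_in by (auto simp: topspace_page_space)
  have "closedin (top_of_set page_dom) X"
    using X by (intro closed_subset compact_imp_closed)
  then have "closedin (top_of_set page_dom) {p \<in> topspace (top_of_set page_dom). page_proj p \<in> page_proj ` X}"
    by (simp only: pre)
  moreover have "page_proj ` X \<subseteq> topspace page_space" using Y by auto
  ultimately have "closedin page_space (page_proj ` X)"
    using quotient_map_page_proj unfolding quotient_map_closedin by blast
  then have "quotient_map (subtopology (top_of_set page_dom) X) ?Y page_proj"
    by (intro quotient_map_restriction quotient_map_page_proj pre) simp
  then have quot: "quotient_map (top_of_set X) ?Y page_proj"
    using X(2) by (simp add: subtopology_subtopology inf.absorb2)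
  have q_cont: "continuous_map (top_of_set X) (top_of_set (q ` X)) q"
    using q(1) by (simp add: continuous_map_in_subtopology)
  have fibre: "page_proj p = page_proj p' \<longleftrightarrow> q p = q p'" if "p \<in> X" "p' \<in> X" for p p'
    using that X(2) q(2)[OF that] page_proj_eq_iff[of p p'] by blast
  obtain h where h: "continuous_map ?Y (top_of_set (q ` X)) h"
      "h ` topspace ?Y = q ` topspace (top_of_set X)"
      "\<And>p. p \<in> topspace (top_of_set X) \<Longrightarrow> h (page_proj p) = q p"
    by (rule quotient_map_lift_exists[OF quot q_cont]) (simp add: fibre, blast)
  have "homeomorphic_map ?Y (top_of_set (q ` X)) h"
  proof (rule continuous_imp_homeomorphic_map[OF h(1)])
    have "compactin (top_of_set X) X" using X(1) by (simp add: compactin_subtopology)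
    then have "compactin ?Y (page_proj ` X)"
      by (rule image_compactin[OF _ quotient_imp_continuous_map[OF quot]])
    then show "compact_space ?Y" unfolding compact_space_def Y .
    show "Hausdorff_space (top_of_set (q ` X))"
      by (simp add: Hausdorff_space_subtopology)
    show "h ` topspace ?Y = topspace (top_of_set (q ` X))" using h(2) by simp
    have "h (page_proj p) = q p" if "p \<in> X" for p using h(3) that by simp
    then show "inj_on h (topspace ?Y)"
      unfolding Y by (intro inj_onI, elim imageE) (simp add: fibre)
  qed
  then show ?thesis by (rule homeomorphic_map_imp_homeomorphic_space)
qed

lemma regular_slice_homeomorphic:
  assumes "0 < r" "r < pi" "compact A" "A \<subseteq> sphere 0 1"
  shows "subtopology page_space ((\<lambda>x. page_proj (x, r)) ` A) homeomorphic_space top_of_set A"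
proof -
  have "subtopology page_space (page_proj ` (A \<times> {r})) homeomorphic_space top_of_set (fst ` (A \<times> {r}))"
  proof (rule page_image_homeomorphic)
    show "compact (A \<times> {r})" using assms by (intro compact_Times) auto
  qed (use assms in \<open>auto simp: page_dom_def page_rel_def intro!: continuous_intros\<close>)
  moreover have "page_proj ` (A \<times> {r}) = (\<lambda>x. page_proj (x, r)) ` A" by force
  ultimately show ?thesis by simp
qed

lemma continuous_on_hopf: "continuous_on S hopf"
proof -
  have "hopf = (\<lambda>x. (2 * (fst (snd x) * snd (snd (snd x)) + fst (snd (snd x)) * fst x),
     2 * (fst (snd x) * fst x - fst (snd (snd x)) * snd (snd (snd x))),
     (fst (snd x))^2 + (fst (snd (snd x)))^2 - (snd (snd (snd x)))^2 - (fst x)^2))"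
    by (auto simp: fun_eq_iff)
  then show ?thesis by (rule ssubst) (intro continuous_intros)
qed

text \<open>At an end the set \<open>A\<close> need not be saturated, but adding all Hopf circles that meet it changes neither
  its image in the quotient nor its image under the Hopf map.\<close>

lemma end_slice_homeomorphic:
  assumes r: "r \<in> {0, pi}" and A: "compact A" "A \<subseteq> sphere 0 1"
  shows "subtopology page_space ((\<lambda>x. page_proj (x, r)) ` A) homeomorphic_space top_of_set (hopf ` A)"
proof -
  define B where "B = sphere 0 1 \<inter> hopf -` (hopf ` A)"
  have "compact (hopf ` A)" using A(1) continuous_on_hopf by (intro compact_continuous_image)
  then have "closed (hopf -` (hopf ` A))"
    by (intro closed_vimage compact_imp_closed) (auto intro: continuous_on_hopf)
  then have B: "compact B" by (simp add: B_def compact_Int_closed)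
  have "subtopology page_space (page_proj ` (B \<times> {r}))
      homeomorphic_space top_of_set ((hopf \<circ> fst) ` (B \<times> {r}))"
  proof (rule page_image_homeomorphic)
    show "compact (B \<times> {r})" using B by (intro compact_Times) auto
    show "continuous_on (B \<times> {r}) (hopf \<circ> fst)"
      by (intro continuous_on_compose continuous_on_fst continuous_on_id continuous_on_hopf)
  qed (use r in \<open>auto simp: page_dom_def page_rel_def B_def simp del: hopf.simps\<close>)
  moreover have "page_proj ` (B \<times> {r}) = (\<lambda>x. page_proj (x, r)) ` A"
  proof
    show "(\<lambda>x. page_proj (x, r)) ` A \<subseteq> page_proj ` (B \<times> {r})"
      using A(2) by (auto simp: B_def simp del: hopf.simps)
    show "page_proj ` (B \<times> {r}) \<subseteq> (\<lambda>x. page_proj (x, r)) ` A"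
    proof clarify
      fix x assume "x \<in> B"
      then obtain y where "y \<in> A" "hopf x = hopf y" "x \<in> sphere 0 1" by (auto simp: B_def simp del: hopf.simps)
      then have "page_proj (x, r) = page_proj (y, r)"
        using A(2) r by (subst page_proj_eq_iff) (auto simp: page_dom_def page_rel_def simp del: hopf.simps)
      then show "page_proj (x, r) \<in> (\<lambda>x. page_proj (x, r)) ` A" using \<open>y \<in> A\<close> by blast
    qed
  qed
  moreover have "(hopf \<circ> fst) ` (B \<times> {r}) = hopf ` A"
    using A(2) by (force simp: B_def simp del: hopf.simps)
  ultimately show ?thesis by simp
qed

lemma euler_in_sphere: "euler \<theta> \<phi> \<psi> \<in> sphere 0 1"
proof -
  have id: "(s * a)^2 + ((c * b)^2 + ((c * d)^2 + (s * e)^2)) = s^2 * (a^2 + e^2) + c^2 * (d^2 + b^2)"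
    for s a c b d e :: real by algebra
  show ?thesis
    by (simp add: euler_def norm_prod_def id)
qed

lemma continuous_on_euler:
  fixes f g h :: "'a::t2_space \<Rightarrow> real"
  assumes "continuous_on S f" "continuous_on S g" "continuous_on S h"
  shows "continuous_on S (\<lambda>u. euler (f u) (g u) (h u))"
  unfolding euler_def by (intro continuous_intros assms) auto

lemma compact_rect: "compact (rect a b c d)"
  by (simp add: rect_def)

lemma in_rect: "u \<in> rect a b c d \<longleftrightarrow> a \<le> u $ 1 \<and> u $ 1 \<le> b \<and> c \<le> u $ 2 \<and> u $ 2 \<le> d"
  by (auto simp: rect_def mem_box_cart forall_2)

lemma image_rect: "(\<lambda>u. F (u $ 1) (u $ 2)) ` rect a b c d = {F s t | s t. s \<in> {a..b} \<and> t \<in> {c..d}}"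
proof safe
  fix s t assume "s \<in> {a..b}" "t \<in> {c..d}"
  then have "vector [s, t] \<in> rect a b c d" by (simp add: in_rect)
  then show "F s t \<in> (\<lambda>u. F (u $ 1) (u $ 2)) ` rect a b c d" by (force intro: rev_image_eqI)
qed (auto simp: in_rect)

lemma carrier_space_slice:
  assumes S: "\<And>u. pmap S u = (r, f u, g u, h u)" "compact (pdom S)"
    and cont: "continuous_on UNIV f" "continuous_on UNIV g" "continuous_on UNIV h"
  defines "A \<equiv> (\<lambda>u. euler (f u) (g u) (h u)) ` pdom S"
  shows "0 < r \<Longrightarrow> r < pi \<Longrightarrow> carrier_space S homeomorphic_space top_of_set A"
    and "r \<in> {0, pi} \<Longrightarrow> carrier_space S homeomorphic_space top_of_set (hopf ` A)"
proof -
  have A: "compact A" unfolding A_def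
    by (intro compact_continuous_image S continuous_on_euler) (auto intro: continuous_on_subset[OF cont(1)]
        continuous_on_subset[OF cont(2)] continuous_on_subset[OF cont(3)])
  have "A \<subseteq> sphere 0 1" unfolding A_def using euler_in_sphere by blast
  moreover have "carrier_space S = subtopology page_space ((\<lambda>x. page_proj (x, r)) ` A)"
    by (simp add: carrier_space_def S A_def image_image)
  ultimately show "0 < r \<Longrightarrow> r < pi \<Longrightarrow> carrier_space S homeomorphic_space top_of_set A"
    "r \<in> {0, pi} \<Longrightarrow> carrier_space S homeomorphic_space top_of_set (hopf ` A)"
    using regular_slice_homeomorphic[OF _ _ A] end_slice_homeomorphic[OF _ A] by auto
qed

lemma transfer_homeomorphic:
  assumes "X homeomorphic_space top_of_set A"
  shows "X homeomorphic_space top_of_set B \<longleftrightarrow> A homeomorphic B"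
  using assms homeomorphic_space_top_of_set homeomorphic_space_sym homeomorphic_space_trans by metis

section \<open>The torus\<close>

abbreviation torus :: "(complex \<times> complex) set" where
  "torus \<equiv> sphere 0 1 \<times> sphere 0 1"

text \<open>The quotient is the stereographic projection of the unit circle from \<open>1\<close>.\<close>

lemma stereographic_inj:
  assumes "cmod z = 1" "cmod w = 1" "z \<noteq> 1" "w \<noteq> 1"
    and eq: "Im z / (1 - Re z) = Im w / (1 - Re w)"
  shows "z = w"
proof -
  have *: "Re z \<noteq> 1 \<and> (Re z)^2 + (Im z)^2 = 1" if "cmod z = 1" "z \<noteq> 1" for z
    using that by (auto simp: cmod_def complex_eq_iff)
  define t where "t = Im z / (1 - Re z)"
  have "Re x = (t^2 - 1) / (t^2 + 1) \<and> Im x = t * (1 - Re x)"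
    if "Re x \<noteq> 1 \<and> (Re x)^2 + (Im x)^2 = 1" "t = Im x / (1 - Re x)" for x
  proof -
    have im: "Im x = t * (1 - Re x)" using that by simp
    have "(Re x)^2 + (t * (1 - Re x))^2 = 1"
      using that(1) unfolding im by simp
    then have "(1 - Re x) * (t^2 * (1 - Re x) - (1 + Re x)) = 0"
      by algebra
    moreover have "1 - Re x \<noteq> 0" using that(1) by simp
    ultimately have "t^2 * (1 - Re x) - (1 + Re x) = 0" using mult_eq_0_iff by blast
    then have "Re x * (t^2 + 1) = t^2 - 1" by (simp add: algebra_simps)
    moreover have "t^2 + 1 > 0" by (intro add_nonneg_pos) auto
    ultimately show ?thesis using im by (simp add: eq_divide_eq)
  qed
  from this[OF *[OF assms(1,3)] t_def] this[OF *[OF assms(2,4)] t_def[unfolded eq]]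
  show ?thesis by (simp add: complex_eq_iff)
qed

text \<open>An open square in the torus that misses the point \<open>(-1, -1)\<close> is mapped into the circle minus one
  point. Followed by stereographic projection, this would embed an open subset of the plane into the
  line, against invariance of dimension.\<close>

lemma torus_does_not_inject_into_circle:
  fixes f :: "complex \<times> complex \<Rightarrow> complex"
  assumes f: "continuous_on torus f" "inj_on f torus" "f ` torus \<subseteq> sphere 0 1"
  shows False
proof -
  define U where "U = box (0 :: complex) (Complex 1 1)"
  define e where "e z = (cis (Re z), cis (Im z))" for z
  define p where "p = f (-1, -1)"
  define s where "s w = Im w / (1 - Re w)" for w
  have U: "open U" "U \<noteq> {}"
    by (auto simp: U_def box_ne_empty Basis_complex_def)
  have inU: "0 < Re z \<and> Re z < 1 \<and> 0 < Im z \<and> Im z < 1" if "z \<in> U" for z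
    using that by (auto simp: U_def mem_box Basis_complex_def)
  have pi1: "1 < pi" using pi_gt3 by simp
  have cis: "cis a = cis b \<Longrightarrow> a = b" "cis a \<noteq> -1" if "0 < a" "a < 1" "0 < b" "b < 1" for a b
  proof -
    show "a = b" if "cis a = cis b"
      using that \<open>0 < a\<close> \<open>a < 1\<close> \<open>0 < b\<close> \<open>b < 1\<close> pi1 cos_inj_pi[of a b] by (simp add: complex_eq_iff)
    show "cis a \<noteq> -1"
      using sin_gt_zero[of a] \<open>0 < a\<close> \<open>a < 1\<close> pi1 by (auto simp: complex_eq_iff)
  qed
  have e: "inj_on e U" "e z \<in> torus" "z \<in> U \<Longrightarrow> e z \<noteq> (-1, -1)" for z
    using inU cis by (auto simp: inj_on_def e_def complex_eq_iff[of "_ :: complex"]) (metis complex_eqI)+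
  have f1: "cmod (f x) = 1" if "x \<in> torus" for x
    using that f(3) by (metis image_subset_iff mem_sphere_0)
  have p: "cmod p = 1" using f1[of "(-1, -1)"] by (simp add: p_def)
  have fe: "cmod (f (e z) / p) = 1" "f (e z) / p \<noteq> 1" if "z \<in> U" for z
  proof -
    show "cmod (f (e z) / p) = 1" using f1[OF e(2)] p by (simp add: norm_divide)
    have "f (e z) \<noteq> p"
      using inj_onD[OF f(2), of "e z" "(-1, -1)"] e(2)[of z] e(3)[OF that] by (auto simp: p_def)
    then show "f (e z) / p \<noteq> 1" using p by auto
  qed
  have "inj_on (\<lambda>z. s (f (e z) / p)) U"
  proof (rule inj_onI)
    fix z w assume zw: "z \<in> U" "w \<in> U" "s (f (e z) / p) = s (f (e w) / p)"
    then have "f (e z) / p = f (e w) / p"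
      by (intro stereographic_inj fe) (auto simp: s_def)
    then have "f (e z) = f (e w)" using p by auto
    then show "z = w" using f(2) e zw by (meson inj_onD)
  qed
  moreover have "continuous_on U (\<lambda>z. s (f (e z) / p))"
  proof -
    have "continuous_on U (\<lambda>z. f (e z))"
      by (rule continuous_on_compose2[OF f(1)]) (use e(2) in \<open>auto simp: e_def intro!: continuous_intros\<close>)
    moreover have "1 - Re (f (e z) / p) \<noteq> 0" if "z \<in> U" for z
      using fe[OF that] by (auto simp: cmod_def complex_eq_iff)
    ultimately show ?thesis
      unfolding s_def using p by (intro continuous_intros) auto
  qed
  ultimately have "DIM(complex) \<le> DIM(real)"
    using U invariance_of_dimension by blast
  then show False by simp
qed

lemma circle_not_homeomorphic_torus:
  fixes j :: "'a::topological_space \<Rightarrow> complex"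
  assumes "continuous_on A j" "inj_on j A" "j ` A \<subseteq> sphere 0 1"
  shows "\<not> A homeomorphic torus"
proof
  assume "A homeomorphic torus"
  then obtain h g where hg: "homeomorphism A torus h g"
    unfolding homeomorphic_def by blast
  then have g: "continuous_on torus g" "g ` torus = A" by (simp_all only: homeomorphism_def)
  have "inj_on g torus"
    by (rule inj_on_inverseI) (rule homeomorphism_apply2[OF hg])
  have "continuous_on torus (j \<circ> g)"
    using g(1,2) assms(1) by (intro continuous_on_compose) auto
  moreover have "inj_on (j \<circ> g) torus"
    using g(2) \<open>inj_on g torus\<close> assms(2) by (intro comp_inj_on) auto
  moreover have "(j \<circ> g) ` torus \<subseteq> sphere 0 1"
    unfolding image_comp[symmetric] g(2) by (rule assms(3))
  ultimately show False by (rule torus_does_not_inject_into_circle)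
qed

text \<open>The angles \<open>\<alpha>\<close>, \<open>\<beta>\<close> of \<open>p\<close> and \<open>q\<close> give \<open>s = \<alpha> + \<beta>\<close> and \<open>t = \<alpha> - \<beta>\<close>. If \<open>t\<close> is negative, it can be raised
  by \<open>2\<pi>\<close> provided that \<open>s\<close> is moved by \<open>2\<pi>\<close> in either direction, and one direction stays in the
  range.\<close>

lemma half_angle_sum_difference:
  assumes "cmod p = 1" "cmod q = 1"
  obtains s t where "s \<in> {0..4 * pi}" "t \<in> {0..2 * pi}" "cis ((s + t) / 2) = p" "cis ((s - t) / 2) = q"
proof -
  have "\<exists>a. 0 \<le> a \<and> a < 2 * pi \<and> cis a = p" if "cmod p = 1" for p
  proof -
    have "(Re p)^2 + (Im p)^2 = 1" using that by (simp add: cmod_def)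
    then obtain a where "0 \<le> a" "a < 2 * pi" "Re p = cos a" "Im p = sin a"
      by (rule sincos_total_2pi)
    then show ?thesis by (intro exI[of _ a]) (simp add: complex_eq_iff)
  qed
  then obtain a b where ab: "0 \<le> a" "a < 2 * pi" "cis a = p" "0 \<le> b" "b < 2 * pi" "cis b = q"
    using assms by metis
  have per: "cis (x + 2 * pi) = cis x" "cis (x - 2 * pi) = cis x" for x
    by (simp_all add: complex_eq_iff cos_diff sin_diff)
  consider "b \<le> a" | "a < b" "a + b \<le> 2 * pi" | "a < b" "a + b > 2 * pi" by linarith
  then show thesis
  proof cases
    case 1
    then show thesis using ab by (intro that[of "a + b" "a - b"]) auto
  next
    case 2
    have h: "((a + b + 2 * pi) + (a - b + 2 * pi)) / 2 = a + 2 * pi"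
      "((a + b + 2 * pi) - (a - b + 2 * pi)) / 2 = b" by (simp_all add: field_simps)
    show thesis
      by (rule that[of "a + b + 2 * pi" "a - b + 2 * pi"], unfold h per) (use 2 ab in auto)
  next
    case 3
    have h: "((a + b - 2 * pi) + (a - b + 2 * pi)) / 2 = a"
      "((a + b - 2 * pi) - (a - b + 2 * pi)) / 2 = b - 2 * pi" by (simp_all add: field_simps)
    show thesis
      by (rule that[of "a + b - 2 * pi" "a - b + 2 * pi"], unfold h per) (use 3 ab in auto)
  qed
qed

lemma torus_eq_half_angles:
  "torus = {(cis ((s + t) / 2), cis ((s - t) / 2)) | s t. s \<in> {0..4 * pi} \<and> t \<in> {0..2 * pi}}"
proof
  show "torus \<subseteq> {(cis ((s + t) / 2), cis ((s - t) / 2)) | s t. s \<in> {0..4 * pi} \<and> t \<in> {0..2 * pi}}"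
  proof clarify
    fix p q :: complex assume "p \<in> sphere 0 1" "q \<in> sphere 0 1"
    then show "\<exists>s t. (p, q) = (cis ((s + t) / 2), cis ((s - t) / 2)) \<and> s \<in> {0..4 * pi} \<and> t \<in> {0..2 * pi}"
      using half_angle_sum_difference[of p q] by (metis mem_sphere_0)
  qed
qed auto

text \<open>Both kinds of tori are parametrized by half sums and half differences of two angles over the same
  rectangle; it remains to give the embedding \<open>m\<close> of the product of circles in each case.\<close>

lemma torus_homeomorphic_image:
  fixes m :: "complex \<times> complex \<Rightarrow> 'a::t2_space"
  assumes "continuous_on torus m" "inj_on m torus"
    and "\<And>s t. m (cis ((s + t) / 2), cis ((s - t) / 2)) = F s t"
  shows "{F s t | s t. s \<in> {0..4 * pi} \<and> t \<in> {0..2 * pi}} homeomorphic torus"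
proof -
  have "m ` torus = {F s t | s t. s \<in> {0..4 * pi} \<and> t \<in> {0..2 * pi}}"
    unfolding torus_eq_half_angles assms(3)[symmetric] by (simp only: set_eq_iff image_iff mem_Collect_eq) blast
  then have "torus homeomorphic {F s t | s t. s \<in> {0..4 * pi} \<and> t \<in> {0..2 * pi}}"
    using assms(1,2) by (intro homeomorphic_compact) (auto intro: compact_Times)
  then show ?thesis by (rule homeomorphic_sym[THEN iffD1])
qed

section \<open>Topology of the coordinate surfaces\<close>

lemma S1_carrier:
  assumes r: "0 < r" "r < pi"
  shows "carrier_space (S1_surface r \<theta>) homeomorphic_space
    top_of_set {euler \<theta> t s | s t. s \<in> {0..4 * pi} \<and> t \<in> {0..2 * pi}}"
  unfolding image_rect[of "\<lambda>s t. euler \<theta> t s", symmetric]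
  using carrier_space_slice(1)[of "S1_surface r \<theta>" r "\<lambda>_. \<theta>" "\<lambda>u. u $ 2" "\<lambda>u. u $ 1"] r
  by (simp add: compact_rect continuous_intros)

text \<open>For \<open>sin \<theta> \<noteq> 0\<close> the image in the 3-sphere is the product of circles of radii \<open>cos (\<theta>/2)\<close> and
  \<open>sin (\<theta>/2)\<close>. Otherwise one radius is zero, and a circle remains.\<close>

lemma S1_is_torus_iff:
  assumes r: "0 < r" "r < pi" and \<theta>: "0 \<le> \<theta>" "\<theta> \<le> pi"
  shows "is_torus (S1_surface r \<theta>) \<longleftrightarrow> sin \<theta> \<noteq> 0"
proof -
  define A where "A = {euler \<theta> t s | s t. s \<in> {0..4 * pi} \<and> t \<in> {0..2 * pi}}"
  have torus: "is_torus (S1_surface r \<theta>) \<longleftrightarrow> A homeomorphic torus"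
    using transfer_homeomorphic[OF S1_carrier[OF r]] by (simp add: is_torus_def A_def)
  show ?thesis
  proof (cases "sin \<theta> = 0")
    case True
    with \<theta> have \<theta>': "\<theta> = 0 \<or> \<theta> = pi"
      using sin_gt_zero[of \<theta>] by force
    \<comment> \<open>For \<open>\<theta> = 0\<close> only \<open>x\<^sub>1, x\<^sub>2\<close> can be nonzero, for \<open>\<theta> = \<pi>\<close> only \<open>x\<^sub>3, x\<^sub>0\<close>; the sum covers both.\<close>
    define j :: "R4 \<Rightarrow> complex" where "j = (\<lambda>(x0, x1, x2, x3). Complex (x1 + x3) (x2 + x0))"
    have "\<not> A homeomorphic torus"
    proof (rule circle_not_homeomorphic_torus)
      show "continuous_on A j"
        unfolding j_def case_prod_beta Complex_eq by (intro continuous_intros)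
      show "inj_on j A" "j ` A \<subseteq> sphere 0 1"
        using \<theta>' by (auto simp: A_def j_def euler_def inj_on_def cmod_def)
    qed
    then show ?thesis using torus True by simp
  next
    case False
    then have half: "sin (\<theta> / 2) \<noteq> 0" "cos (\<theta> / 2) \<noteq> 0"
      using sin_double[of "\<theta> / 2"] by auto
    define m :: "complex \<times> complex \<Rightarrow> R4" where
      "m = (\<lambda>(p, q). (sin (\<theta>/2) * Im q, cos (\<theta>/2) * Re p, cos (\<theta>/2) * Im p, sin (\<theta>/2) * Re q))"
    have "A homeomorphic torus"
      unfolding A_def
    proof (rule torus_homeomorphic_image)
      show "continuous_on torus m"
        unfolding m_def case_prod_beta by (intro continuous_intros)
      show "inj_on m torus"
        using half by (auto simp: inj_on_def m_def complex_eq_iff)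
      show "m (cis ((s + t) / 2), cis ((s - t) / 2)) = euler \<theta> t s" for s t
        by (simp add: m_def euler_def)
    qed
    then show ?thesis using torus False by simp
  qed
qed

text \<open>The surface is a rotated Clifford torus. In the complex coordinates \<open>z\<^sub>1 = x\<^sub>1 + \<i> x\<^sub>2\<close> and
  \<open>z\<^sub>2 = x\<^sub>3 + \<i> x\<^sub>0\<close> its points are \<open>cis (\<psi>/2)\<close> times \<open>(cos (\<theta>/2), sin (\<theta>/2))\<close>, up to a fixed phase in
  each coordinate. With these phases removed, \<open>z\<^sub>1 + \<i> z\<^sub>2\<close> and \<open>z\<^sub>1 - \<i> z\<^sub>2\<close> are the independent unit
  complex numbers \<open>cis ((\<psi> + \<theta>)/2)\<close> and \<open>cis ((\<psi> - \<theta>)/2)\<close>; the proof inverts this linear map.\<close>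

lemma S3_is_torus:
  assumes r: "0 < r" "r < pi"
  shows "is_torus (S3_surface r \<phi>)"
proof -
  define A where "A = {euler t \<phi> s | s t. s \<in> {0..4 * pi} \<and> t \<in> {0..2 * pi}}"
  have "carrier_space (S3_surface r \<phi>) homeomorphic_space top_of_set A"
    unfolding image_rect[of "\<lambda>s t. euler t \<phi> s", symmetric] A_def
    using carrier_space_slice(1)[of "S3_surface r \<phi>" r "\<lambda>u. u $ 2" "\<lambda>_. \<phi>" "\<lambda>u. u $ 1"] r
    by (simp add: compact_rect continuous_intros)
  moreover have "A homeomorphic torus"
    unfolding A_def
  proof (rule torus_homeomorphic_image)
    define c where "c = \<phi> / 2"
    define z1 z2 :: "complex \<times> complex \<Rightarrow> complex" where
      "z1 x = cis c * (fst x + snd x) / 2" and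
      "z2 x = cis (- c) * (fst x - snd x) / (2 * \<i>)" for x
    define m where "m x = (Im (z2 x), Re (z1 x), Im (z1 x), Re (z2 x))" for x
    show "continuous_on torus m"
      unfolding m_def z1_def z2_def by (intro continuous_intros) auto
    have "x = y" if "z1 x = z1 y" "z2 x = z2 y" for x y
    proof -
      have "fst x + snd x = fst y + snd y" "fst x - snd x = fst y - snd y"
        using that by (auto simp: z1_def z2_def)
      then show ?thesis by (auto simp: prod_eq_iff complex_eq_iff)
    qed
    then show "inj_on m torus"
      by (auto simp: inj_on_def m_def complex_eq_iff)
    show "m (cis ((s + t) / 2), cis ((s - t) / 2)) = euler t \<phi> s" for s t
    proof -
      have h: "(s + t) / 2 = s / 2 + t / 2" "(s - t) / 2 = s / 2 - t / 2"
        "(s + \<phi>) / 2 = s / 2 + c" "(s - \<phi>) / 2 = s / 2 - c"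
        by (simp_all add: c_def field_simps)
      have "m (cis (a + b), cis (a - b)) =
          (sin b * sin (a - c), cos b * cos (a + c), cos b * sin (a + c), sin b * cos (a - c))"
        for a b
        by (simp add: m_def z1_def z2_def cos_add sin_add cos_diff sin_diff Re_divide Im_divide)
          (simp add: field_simps)
      then show ?thesis
        unfolding euler_def h by simp
    qed
  qed
  ultimately show ?thesis
    unfolding is_torus_def by (rule transfer_homeomorphic[THEN iffD2])
qed

text \<open>At an end the Hopf circles are collapsed, and the image under the Hopf map is a great circle of the
  2-sphere, through the poles and at longitude \<open>- \<phi>\<close>.\<close>

lemma S3_end_not_torus:
  assumes r: "r \<in> {0, pi}"
  shows "\<not> is_torus (S3_surface r \<phi>)"
proof -
  define A where "A = (\<lambda>u. euler (u $ 2) \<phi> (u $ 1)) ` rect 0 (4 * pi) 0 (2 * pi)"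
  have "carrier_space (S3_surface r \<phi>) homeomorphic_space top_of_set (hopf ` A)"
    unfolding A_def
    using carrier_space_slice(2)[of "S3_surface r \<phi>" r "\<lambda>u. u $ 2" "\<lambda>_. \<phi>" "\<lambda>u. u $ 1"] r
    by (simp add: compact_rect continuous_intros)
  then have torus: "is_torus (S3_surface r \<phi>) \<longleftrightarrow> hopf ` A homeomorphic torus"
    using transfer_homeomorphic by (simp add: is_torus_def)
  \<comment> \<open>rotating by \<open>\<phi>\<close> about the polar axis brings the great circle into a coordinate plane\<close>
  define j where "j = (\<lambda>(x, y, z). Complex z (x * cos \<phi> - y * sin \<phi>))"
  have j: "j (sin t * cos (- \<phi>), sin t * sin (- \<phi>), cos t) = cis t" for t
  proof -
    have "sin t * cos \<phi> * cos \<phi> + sin t * sin \<phi> * sin \<phi> = sin t * ((sin \<phi>)^2 + (cos \<phi>)^2)"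
      by (simp add: power2_eq_square algebra_simps del: sin_cos_squared_add sin_cos_squared_add2
        sin_cos_squared_add3)
    then show ?thesis by (simp add: j_def complex_eq_iff)
  qed
  have A: "hopf ` A \<subseteq> range (\<lambda>t. (sin t * cos (- \<phi>), sin t * sin (- \<phi>), cos t))"
    by (auto simp only: A_def image_image hopf_euler)
  have "\<not> hopf ` A homeomorphic torus"
  proof (rule circle_not_homeomorphic_torus)
    show "continuous_on (hopf ` A) j"
      unfolding j_def case_prod_beta Complex_eq by (intro continuous_intros)
    have "inj_on j (range (\<lambda>t. (sin t * cos (- \<phi>), sin t * sin (- \<phi>), cos t)))"
      by (rule inj_onI, elim rangeE, simp only: j) (simp add: complex_eq_iff)
    then show "inj_on j (hopf ` A)" by (rule inj_on_subset[OF _ A])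
    show "j ` (hopf ` A) \<subseteq> sphere 0 1"
    proof
      fix w assume "w \<in> j ` (hopf ` A)"
      then obtain x where x: "x \<in> hopf ` A" "w = j x" by blast
      then obtain t where "x = (sin t * cos (- \<phi>), sin t * sin (- \<phi>), cos t)"
        using subsetD[OF A] by (elim imageE rangeE) blast
      with x have "w = j (sin t * cos (- \<phi>), sin t * sin (- \<phi>), cos t)" by (simp only:)
      then show "w \<in> sphere 0 1" by (simp only: j) simp
    qed
  qed
  then show ?thesis using torus by simp
qed

text \<open>By \<open>hopf_euler\<close> these are spherical coordinates on the 2-sphere.\<close>

lemma hopf_image_S6:
  "hopf ` {euler t s \<psi> | s t. s \<in> {0..2 * pi} \<and> t \<in> {0..pi}} = sphere 0 1"
proof
  have n: "norm (hopf (euler t s \<psi>)) = 1" for t s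
  proof -
    have "(sin t * cos s)^2 + ((sin t * sin s)^2 + (cos t)^2)
        = (sin t)^2 * ((sin s)^2 + (cos s)^2) + (cos t)^2" by algebra
    then show ?thesis by (simp add: hopf_euler norm_prod_def)
  qed
  show "hopf ` {euler t s \<psi> | s t. s \<in> {0..2 * pi} \<and> t \<in> {0..pi}} \<subseteq> sphere 0 1"
    using n by auto
  show "sphere 0 1 \<subseteq> hopf ` {euler t s \<psi> | s t. s \<in> {0..2 * pi} \<and> t \<in> {0..pi}}"
  proof clarify
    fix x y z :: real assume "(x, y, z) \<in> sphere 0 1"
    then have xyz: "x^2 + (y^2 + z^2) = 1" by (simp add: norm_prod_def)
    moreover have "0 \<le> x^2" "0 \<le> y^2" by auto
    ultimately have "z^2 \<le> 1" by linarith
    then have z: "-1 \<le> z" "z \<le> 1" by (auto simp: abs_square_le_1)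
    define t where "t = arccos z"
    have t: "t \<in> {0..pi}" "cos t = z" using z by (auto simp: t_def arccos_lbound arccos_ubound)
    have xy: "x^2 + y^2 = (sin t)^2" using xyz t(2) by (simp add: sin_squared_eq)
    obtain s where s: "s \<in> {0..2 * pi}" "x = sin t * cos s" "- y = sin t * sin s"
    proof (cases "sin t = 0")
      case True
      then have "x = 0" "y = 0" using xy by (auto simp: sum_power2_eq_zero_iff)
      then show thesis using True that[of 0] by simp
    next
      case False
      then have "(x / sin t)^2 + (- y / sin t)^2 = 1"
        using xy by (simp add: power_divide add_divide_distrib[symmetric])
      then obtain s where "0 \<le> s" "s < 2 * pi" "x / sin t = cos s" "- y / sin t = sin s"
        by (rule sincos_total_2pi)
      then show thesis using False that[of s] by (simp add: field_simps)
    qed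
    then have "(x, y, z) = hopf (euler t s \<psi>)" using t(2) by (simp add: hopf_euler)
    then show "(x, y, z) \<in> hopf ` {euler t s \<psi> | s t. s \<in> {0..2 * pi} \<and> t \<in> {0..pi}}"
      using s(1) t(1) by blast
  qed
qed

lemma S6_hopf_image_rect:
  "hopf ` ((\<lambda>u. euler (u $ 2) (u $ 1) \<psi>) ` rect 0 (2 * pi) 0 pi) = sphere 0 1"
  using hopf_image_S6[of \<psi>] by (simp only: image_rect[of "\<lambda>s t. euler t s \<psi>"])

lemma S6_end_is_sphere:
  assumes r: "r \<in> {0, pi}"
  shows "is_sphere (S6_surface r \<psi>)"
proof -
  have "carrier_space (S6_surface r \<psi>) homeomorphic_space top_of_set (sphere (0 :: real \<times> real \<times> real) 1)"
    using carrier_space_slice(2)[of "S6_surface r \<psi>" r "\<lambda>u. u $ 2" "\<lambda>u. u $ 1" "\<lambda>_. \<psi>"] r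
    by (simp add: S6_surface_def S6_hopf_image_rect compact_rect continuous_intros)
  moreover have "sphere (0 :: real \<times> real \<times> real) 1 homeomorphic sphere (0 :: real^3) 1"
    by (rule homeomorphic_spheres') auto
  ultimately show ?thesis
    unfolding is_sphere_def by (rule transfer_homeomorphic[THEN iffD2])
qed

lemma cos_sin_eq_imp_eq:
  assumes "cos a = cos b" "sin a = sin b" "\<bar>a - b\<bar> < 2 * pi"
  shows "a = b"
proof -
  have "cos (a - b) = 1"
    using assms(1,2) sin_cos_squared_add3[of b] by (simp add: cos_diff add.commute)
  then obtain n :: int where "a - b = of_int n * 2 * pi"
    by (auto simp: cos_one_2pi_int)
  moreover from this have "\<bar>of_int n\<bar> < (1 :: real)"
    using assms(3) by (simp add: abs_mult)
  ultimately have "a - b = of_int n * 2 * pi" "n = 0" by (simp, linarith)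
  then show ?thesis by simp
qed

text \<open>The parametrization is injective on the whole closed rectangle: \<open>\<theta>\<close> is determined by the Hopf image,
  and \<open>\<phi>\<close> by the phase of a nonzero complex coordinate, where only \<open>\<phi>/2\<close> enters, so that even \<open>\<phi> = 0\<close> and
  \<open>\<phi> = 2\<pi>\<close> give different points. Hence the surface is a closed disc.\<close>

lemma S6_regular_not_sphere:
  assumes r: "0 < r" "r < pi"
  shows "\<not> is_sphere (S6_surface r \<psi>)"
proof
  define R where "R = rect 0 (2 * pi) 0 pi"
  define F where "F u = euler (u $ 2) (u $ 1) \<psi>" for u :: "real^2"
  have carrier: "carrier_space (S6_surface r \<psi>) homeomorphic_space top_of_set (F ` R)"
    using carrier_space_slice(1)[of "S6_surface r \<psi>" r "\<lambda>u. u $ 2" "\<lambda>u. u $ 1" "\<lambda>_. \<psi>"] r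
    by (simp add: S6_surface_def F_def R_def compact_rect continuous_intros)
  have "inj_on F R"
  proof (rule inj_onI)
    fix u w assume u: "u \<in> R" and w: "w \<in> R" and eq: "F u = F w"
    have bounds: "0 \<le> u $ 1" "u $ 1 \<le> 2 * pi" "0 \<le> u $ 2" "u $ 2 \<le> pi"
      "0 \<le> w $ 1" "w $ 1 \<le> 2 * pi" "0 \<le> w $ 2" "w $ 2 \<le> pi"
      using u w by (simp_all add: R_def in_rect)
    have "hopf (F u) = hopf (F w)" by (simp only: eq)
    then have "cos (u $ 2) = cos (w $ 2)" by (simp add: F_def hopf_euler)
    then have 2: "u $ 2 = w $ 2"
      by (rule cos_inj_pi[OF bounds(3,4,7,8)])
    define c s where "c = cos (w $ 2 / 2)" and "s = sin (w $ 2 / 2)"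
    have eqs: "s * sin ((\<psi> - u $ 1) / 2) = s * sin ((\<psi> - w $ 1) / 2)"
      "c * cos ((\<psi> + u $ 1) / 2) = c * cos ((\<psi> + w $ 1) / 2)"
      "c * sin ((\<psi> + u $ 1) / 2) = c * sin ((\<psi> + w $ 1) / 2)"
      "s * cos ((\<psi> - u $ 1) / 2) = s * cos ((\<psi> - w $ 1) / 2)"
      using eq unfolding F_def euler_def 2 c_def s_def by (simp_all only: prod.inject)
    have diff1: "\<bar>(\<psi> + u $ 1) / 2 - (\<psi> + w $ 1) / 2\<bar> < 2 * pi"
      using bounds pi_gt_zero unfolding abs_less_iff by argo
    have diff2: "\<bar>(\<psi> - u $ 1) / 2 - (\<psi> - w $ 1) / 2\<bar> < 2 * pi"
      using bounds pi_gt_zero unfolding abs_less_iff by argo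
    have "u $ 1 = w $ 1"
    proof (cases "c = 0")
      case False
      have "(\<psi> + u $ 1) / 2 = (\<psi> + w $ 1) / 2"
        using eqs False diff1 by - (rule cos_sin_eq_imp_eq, simp_all)
      then show ?thesis by simp
    next
      case True
      then have "s \<noteq> 0" using sin_zero_abs_cos_one[of "w $ 2 / 2"] by (auto simp: c_def s_def)
      have "(\<psi> - u $ 1) / 2 = (\<psi> - w $ 1) / 2"
        using eqs \<open>s \<noteq> 0\<close> diff2 by - (rule cos_sin_eq_imp_eq, simp_all)
      then show ?thesis by simp
    qed
    with 2 show "u = w" by (simp add: vec_eq_iff forall_2)
  qed
  then have "R homeomorphic F ` R"
    by (intro homeomorphic_compact)
      (auto simp: F_def R_def compact_rect intro!: continuous_on_euler continuous_intros)
  moreover have "contractible R"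
    by (simp add: R_def rect_def convex_imp_contractible)
  ultimately have disc: "contractible (F ` R)" by (simp add: homeomorphic_contractible_eq)
  assume "is_sphere (S6_surface r \<psi>)"
  then have "F ` R homeomorphic sphere (0 :: real^3) 1"
    unfolding is_sphere_def by (rule transfer_homeomorphic[OF carrier, THEN iffD1])
  then have "contractible (sphere (0 :: real^3) 1)"
    using disc homeomorphic_contractible_eq by blast
  then show False by (simp add: contractible_sphere)
qed

section \<open>The classification\<close>

theorem theorem2:
  shows "(\<forall>S \<in> S1 \<union> S3. is_torus S \<longrightarrow> flat S)
    \<and> (\<forall>S \<in> S6. is_sphere S \<longrightarrow> (\<exists>k > 0. const_curvature S k))
    \<and> (\<forall>S \<in> S1 \<union> S2 \<union> S3 \<union> S4 \<union> S5 \<union> S6. \<forall>k. const_curvature S k \<longrightarrow>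
          (S \<in> S1 \<union> S3 \<and> is_torus S)
        \<or> (S \<in> S6 \<and> is_sphere S)
        \<or> (\<exists>r \<in> {0<..<pi}. \<exists>\<psi> \<in> {0..4 * pi}. S = S6_surface r \<psi>
              \<and> page_f r = page_C * (sin r)^2 / page_V r \<and> flat S))"
proof (intro conjI ballI impI allI)
  have ends: "r \<in> {0, pi} \<or> 0 < r \<and> r < pi" if "r \<in> {0..pi}" for r
    using that by auto
  show "flat S" if "S \<in> S1 \<union> S3" "is_torus S" for S
    using that(1)
  proof
    assume "S \<in> S1"
    then obtain r \<theta> where S: "S = S1_surface r \<theta>" "0 < r" "r < pi" "0 \<le> \<theta>" "\<theta> \<le> pi"
      by (auto simp: S1_def)
    then show "flat S" using S1_flat S1_is_torus_iff that(2) by blast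
  next
    assume "S \<in> S3"
    then obtain r \<phi> where S: "S = S3_surface r \<phi>" "r \<in> {0..pi}"
      unfolding S3_def by blast
    then show "flat S" using S3_flat S3_end_not_torus ends that(2) by blast
  qed
  show "\<exists>k > 0. const_curvature S k" if "S \<in> S6" and sphere: "is_sphere S" for S
  proof -
    obtain r \<psi> where S: "S = S6_surface r \<psi>" "r \<in> {0..pi}"
      using \<open>S \<in> S6\<close> unfolding S6_def by blast
    then have "r \<in> {0, pi}" using ends S6_regular_not_sphere sphere by blast
    then have "const_curvature S (4 / page_f r)" unfolding S(1) by (rule S6_end_const_curvature)
    moreover have "4 / page_f r > 0" using page_f_pos by simp
    ultimately show ?thesis by blast
  qed
  show "(S \<in> S1 \<union> S3 \<and> is_torus S)
        \<or> (S \<in> S6 \<and> is_sphere S)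
        \<or> (\<exists>r \<in> {0<..<pi}. \<exists>\<psi> \<in> {0..4 * pi}. S = S6_surface r \<psi>
              \<and> page_f r = page_C * (sin r)^2 / page_V r \<and> flat S)"
    if S: "S \<in> S1 \<union> S2 \<union> S3 \<union> S4 \<union> S5 \<union> S6" and k: "const_curvature S k" for S k
  proof -
    from S consider "S \<in> S1" | "S \<in> S2 \<union> S4 \<union> S5" | "S \<in> S3" | "S \<in> S6" by blast
    then show ?thesis
    proof cases
      case 1
      then obtain r \<theta> where S: "S = S1_surface r \<theta>" "0 < r" "r < pi" "0 \<le> \<theta>" "\<theta> \<le> pi"
        by (auto simp: S1_def)
      then have "is_torus S" using S1_is_torus_iff S1_nondegenerate k by blast
      with 1 show ?thesis by blast
    next
      case 2
      then have False
        using k S2_not_constant_curvature S4_not_constant_curvature S5_not_constant_curvature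
        unfolding S2_def S4_def S5_def by blast
      then show ?thesis ..
    next
      case 3
      then obtain r \<phi> where S: "S = S3_surface r \<phi>" "r \<in> {0..pi}"
        unfolding S3_def by blast
      then have "is_torus S" using S3_is_torus S3_nondegenerate k ends by blast
      with 3 show ?thesis by blast
    next
      case 4
      then obtain r \<psi> where S: "S = S6_surface r \<psi>" "r \<in> {0..pi}" "\<psi> \<in> {0..4 * pi}"
        unfolding S6_def by blast
      from ends[OF S(2)] show ?thesis
      proof
        assume "r \<in> {0, pi}"
        then have "is_sphere S" unfolding S(1) by (rule S6_end_is_sphere)
        with 4 show ?thesis by blast
      next
        assume r: "0 < r \<and> r < pi"
        then have "page_f r = page_h r" "flat S"
          using S6_regular_const_curvature_imp_flat k unfolding S(1) by blast+
        then show ?thesis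
          using S r by (intro disjI2 bexI[of _ r] bexI[of _ \<psi>]) (auto simp: page_h_def)
      qed
    qed
  qed
qed

end
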